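(* Suppose the mask distribution $\mathcal{M}$ satisfies the assumption: the set $\{\mu\odot(2M_0-\mathbf 1): M_0\in\mathrm{support}(M)\}$ spans $\mathbb{R}^d$, and $\mathbb{P}[\lambda\,\mathbf 1_{M=M_0}\notin\{0,1\}]>0$ for each $M_0\in\mathrm{support}(M)$, where $(M,\lambda)\sim\mathcal{M}$. Let $n\ge2$. Then for every $\kappa\in(0,\infty]$, with $S=\{(x_i,y_i)\}_{i=1}^n$ drawn i.i.d. from $\mathcal{D}_\kappa$, the expected loss $w\mapsto\mathbb{E}_\kappa[\mathcal{L}_S^{\mathrm{mask}}(w)]$ has a unique minimizer $w^*_{\mathrm{mask}}(n,\kappa)$ over $\mathbb{R}^d$. In addition, $$\lim_{\kappa\to\infty}w^*_{\mathrm{mask}}(n,\kappa)=w^*_{\mathrm{mask}}(n,\infty).$$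
   Context: Fix $d\ge 1$, a nonzero vector $\mu\in\mathbb{R}^d$ and a (symmetric) positive definite matrix $\Sigma\in\mathbb{R}^{d\times d}$ with $\|\mu\|^2=\|\Sigma\|$ ($\ell_2$ norm for vectors, spectral norm for matrices). For $\kappa\in(0,\infty)$, $\mathcal{D}_\kappa$ is the distribution of $(x,y)\in\mathbb{R}^d\times\{0,1\}$ with $y$ uniform on $\{0,1\}$, $x\mid y=1\sim N(\mu,\kappa^{-1}\Sigma)$ and $x\mid y=0\sim N(-\mu,\kappa^{-1}\Sigma)$. Under $\mathcal{D}_\infty$, $y$ is uniform on $\{0,1\}$ and $x=(2y-1)\mu$. Let $l(z)=\log(1+e^{-z})$. Masking-based Mixup: $\mathcal{M}$ is a probability distribution with support contained in $\{0,1\}^d\times[0,1]$; $(M_{i,j},\lambda_{i,j})$ ($1\le i,j\le n$) are i.i.d. from $\mathcal{M}$, independent of $S$; $\odot$ is the entrywise product and $\mathbf 1$ the all-ones vector; $$\tilde x^{\mathrm{mask}}_{i,j}=M_{i,j}\odot x_i+(\mathbf 1-M_{i,j})\odot x_j,\qquad \tilde y^{\mathrm{mask}}_{i,j}=\lambda_{i,j}y_i+(1-\lambda_{i,j})y_j.$$ The masking-based Mixup loss is $$\mathcal{L}_S^{\mathrm{mask}}(w)=\frac1{n^2}\sum_{i,j=1}^n\big[\tilde y^{\mathrm{mask}}_{i,j}\,l(w^\top\tilde x^{\mathrm{mask}}_{i,j})+(1-\tilde y^{\mathrm{mask}}_{i,j})\,l(-w^\top\tilde x^{\mathrm{mask}}_{i,j})\big].$$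 $\mathbb{E}_\kappa$ is expectation over $S$ and the $(M_{i,j},\lambda_{i,j})$. In the assumption, $\mathbf 1_{M=M_0}$ is the $0$-$1$ indicator and $\mathrm{support}(M)$ is the support of the marginal law of $M$. *)

theory Defs
  imports "HOL-Probability.Probability"
begin

definition pos_def_matrix :: "real^'d^'d \<Rightarrow> bool" where
  "pos_def_matrix A \<longleftrightarrow> transpose A = A \<and> (\<forall>x. x \<noteq> 0 \<longrightarrow> 0 < x \<bullet> (A *v x))"

definition spectral_norm :: "real^'d^'d \<Rightarrow> real" where
  "spectral_norm A = onorm ((*v) A)"

text \<open>The Gaussian law \<open>N(m, C)\<close>, for positive definite covariance \<open>C\<close>, via its Lebesgue density.\<close>

definition gaussian_density :: "real^'d \<Rightarrow> real^'d^'d \<Rightarrow> real^'d \<Rightarrow> real" where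
  "gaussian_density m C x =
     exp (- ((x - m) \<bullet> (matrix_inv C *v (x - m))) / 2) / sqrt ((2 * pi) ^ CARD('d) * det C)"

definition gaussian :: "real^'d \<Rightarrow> real^'d^'d \<Rightarrow> (real^'d) measure" where
  "gaussian m C = density lborel (\<lambda>x. ennreal (gaussian_density m C x))"

definition class_law :: "real^'d^'d \<Rightarrow> ereal \<Rightarrow> real^'d \<Rightarrow> (real^'d) measure" where
  "class_law \<Sigma> \<kappa> m =
     (if \<kappa> = \<infinity> then return borel m else gaussian m (inverse (real_of_ereal \<kappa>) *\<^sub>R \<Sigma>))"

text \<open>The data distribution. The label \<open>y\<close> is uniform on \<open>{0, 1}\<close> (as a real number) and
  \<open>(2y - 1)\<mu>\<close> is the mean of \<open>x\<close> given \<open>y\<close>, so \<open>\<mu>\<close> for \<open>y = 1\<close> and \<open>-\<mu>\<close> for \<open>y = 0\<close>.\<close>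

definition data_law :: "real^'d \<Rightarrow> real^'d^'d \<Rightarrow> ereal \<Rightarrow> ((real^'d) \<times> real) measure" where
  "data_law \<mu> \<Sigma> \<kappa> =
     measure_pmf (pmf_of_set {0, 1}) \<bind>
       (\<lambda>y. distr (class_law \<Sigma> \<kappa> ((2 * y - 1) *\<^sub>R \<mu>)) borel (\<lambda>x. (x, y)))"

text \<open>The topological support of a Borel measure.\<close>

definition msupport :: "'a::topological_space measure \<Rightarrow> 'a set" where
  "msupport P = {x. \<forall>U. open U \<longrightarrow> x \<in> U \<longrightarrow> 0 < emeasure P U}"

definition logistic_loss :: "real \<Rightarrow> real" where
  "logistic_loss z = ln (1 + exp (- z))"

text \<open>On \<open>real^'d\<close>, the operation \<open>*\<close> is the entrywise product and \<open>1\<close> is the all-ones vector.\<close>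

definition mask_mix_x :: "real^'d \<Rightarrow> real^'d \<Rightarrow> real^'d \<Rightarrow> real^'d" where
  "mask_mix_x M x x' = M * x + (1 - M) * x'"

definition mask_mix_y :: "real \<Rightarrow> real \<Rightarrow> real \<Rightarrow> real" where
  "mask_mix_y l y y' = l * y + (1 - l) * y'"

definition mask_loss ::
  "nat \<Rightarrow> (nat \<Rightarrow> (real^'d) \<times> real) \<Rightarrow> (nat \<times> nat \<Rightarrow> (real^'d) \<times> real) \<Rightarrow> real^'d \<Rightarrow> real" where
  "mask_loss n S T w = 1 / (real n)\<^sup>2 * (\<Sum>i = 1..n. \<Sum>j = 1..n.
     (let x = mask_mix_x (fst (T (i, j))) (fst (S i)) (fst (S j));
          y = mask_mix_y (snd (T (i, j))) (snd (S i)) (snd (S j))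
      in y * logistic_loss (w \<bullet> x) + (1 - y) * logistic_loss (- (w \<bullet> x))))"

text \<open>The joint law of the sample \<open>(x\<^sub>i, y\<^sub>i)\<close> and the masks \<open>(M\<^sub>i\<^sub>j, \<lambda>\<^sub>i\<^sub>j)\<close>, all independent.\<close>

definition sample_law ::
  "real^'d \<Rightarrow> real^'d^'d \<Rightarrow> ((real^'d) \<times> real) measure \<Rightarrow> nat \<Rightarrow> ereal
    \<Rightarrow> ((nat \<Rightarrow> (real^'d) \<times> real) \<times> (nat \<times> nat \<Rightarrow> (real^'d) \<times> real)) measure" where
  "sample_law \<mu> \<Sigma> \<M> n \<kappa> =
     (\<Pi>\<^sub>M i\<in>{1..n}. data_law \<mu> \<Sigma> \<kappa>) \<Otimes>\<^sub>M (\<Pi>\<^sub>M ij\<in>{1..n} \<times> {1..n}. \<M>)"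

definition expected_mask_loss ::
  "real^'d \<Rightarrow> real^'d^'d \<Rightarrow> ((real^'d) \<times> real) measure \<Rightarrow> nat \<Rightarrow> ereal \<Rightarrow> real^'d \<Rightarrow> real" where
  "expected_mask_loss \<mu> \<Sigma> \<M> n \<kappa> w =
     (\<integral>(S, T). mask_loss n S T w \<partial>sample_law \<mu> \<Sigma> \<M> n \<kappa>)"

text \<open>\<open>w_mask\<close> is meaningful where the expected loss has exactly one minimizer over all of \<open>real^'d\<close>.\<close>

definition w_mask ::
  "real^'d \<Rightarrow> real^'d^'d \<Rightarrow> ((real^'d) \<times> real) measure \<Rightarrow> nat \<Rightarrow> ereal \<Rightarrow> real^'d" where
  "w_mask \<mu> \<Sigma> \<M> n \<kappa> = arg_min (expected_mask_loss \<mu> \<Sigma> \<M> n \<kappa>) (\<lambda>w. True)"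

definition mask_distribution :: "((real^'d) \<times> real) measure \<Rightarrow> bool" where
  "mask_distribution \<M> \<longleftrightarrow> prob_space \<M> \<and> sets \<M> = sets borel \<and>
     msupport \<M> \<subseteq> {M. \<forall>i. M $ i \<in> {0, 1}} \<times> {0..1}"

definition mask_assumption :: "real^'d \<Rightarrow> ((real^'d) \<times> real) measure \<Rightarrow> bool" where
  "mask_assumption \<mu> \<M> \<longleftrightarrow>
     span ((\<lambda>M\<^sub>0. \<mu> * (2 *\<^sub>R M\<^sub>0 - 1)) ` msupport (distr \<M> borel fst)) = UNIV \<and>
     (\<forall>M\<^sub>0 \<in> msupport (distr \<M> borel fst).
        0 < measure \<M> {(M, l). l * indicat_real {M\<^sub>0} M \<notin> {0, 1}})"

end

theory Submission
  imports Defs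
begin

text \<open>A sample from \<open>\<D>\<^sub>\<kappa>\<close> is \<open>x = (2y - 1)\<mu> + s g\<close> with \<open>g \<sim> N(0, \<Sigma>)\<close> and \<open>s = \<kappa>\<^sup>-\<^sup>1\<^sup>/\<^sup>2\<close>
  (\<open>s = 0\<close> for \<open>\<kappa> = \<infinity>\<close>), so all expected losses \<open>F\<^sub>s\<close> live on one probability space.
  Each \<open>F\<^sub>s\<close> is strictly convex, and coercive because it dominates the expected hinge loss,
  which is positively homogeneous. Both follow from the same non-degeneracy condition: no \<open>w \<noteq> 0\<close>
  classifies every mixed point correctly almost surely. For \<open>s > 0\<close> this holds by the full support of the
  Gaussian in the terms \<open>i = j\<close>, for \<open>s = 0\<close> by the span and \<open>\<lambda>\<close> conditions in the terms \<open>i \<noteq> j\<close>.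
  Since the loss is 1-Lipschitz, \<open>\<bar>F\<^sub>s w - F\<^sub>0 w\<bar> \<le> C s \<parallel>w\<parallel>\<close>, which together with the coercivity of \<open>F\<^sub>0\<close>
  forces the minimizers to converge.\<close>

section \<open>Gaussian measures\<close>

text \<open>Integrate the coordinate along \<open>b\<close> innermost. Since \<open>u\<close> is
  orthogonal to \<open>b\<close>, the number \<open>u \<bullet> x\<close> depends on the other
  coordinates only, so within the inner integral the shear is a translation of the real
  line.\<close>

lemma nn_integral_lborel_shear:
  fixes u b :: "'a::euclidean_space" and f :: "'a \<Rightarrow> ennreal"
  assumes b: "b \<in> Basis" and ub: "u \<bullet> b = 0" and [measurable]: "f \<in> borel_measurable borel"
  shows "(\<integral>\<^sup>+x. f (x + (u \<bullet> x) *\<^sub>R b) \<partial>lborel) = (\<integral>\<^sup>+x. f x \<partial>lborel)"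
proof -
  let ?B = "Basis - {b}"
  let ?s = "\<lambda>g. \<Sum>c\<in>?B. g c *\<^sub>R c"
  interpret product_sigma_finite "\<lambda>_::'a. lborel :: real measure" by standard
  \<comment> \<open>Fubini for \<open>lborel\<close> as the image of a product measure, with the
    coordinate \<open>b\<close> separated from the rest.\<close>
  have split: "(\<integral>\<^sup>+x. h x \<partial>lborel) = (\<integral>\<^sup>+g. (\<integral>\<^sup>+y. h (?s g + y *\<^sub>R b) \<partial>lborel) \<partial>(\<Pi>\<^sub>M c\<in>?B. lborel))"
    if [measurable]: "h \<in> borel_measurable borel" for h :: "'a \<Rightarrow> ennreal"
  proof -
    have "(\<integral>\<^sup>+x. h x \<partial>lborel)
        = (\<integral>\<^sup>+g. h (\<Sum>c\<in>insert b ?B. g c *\<^sub>R c) \<partial>(\<Pi>\<^sub>M c\<in>insert b ?B. lborel))"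
      using b by (subst lborel_eq) (simp add: nn_integral_distr insert_absorb)
    also have "\<dots> = (\<integral>\<^sup>+g. (\<integral>\<^sup>+y. h (\<Sum>c\<in>insert b ?B. (g(b := y)) c *\<^sub>R c) \<partial>lborel) \<partial>(\<Pi>\<^sub>M c\<in>?B. lborel))"
      by (rule product_nn_integral_insert) auto
    also have "\<dots> = (\<integral>\<^sup>+g. (\<integral>\<^sup>+y. h (?s g + y *\<^sub>R b) \<partial>lborel) \<partial>(\<Pi>\<^sub>M c\<in>?B. lborel))"
      by (intro nn_integral_cong arg_cong[of _ _ h], subst sum.insert) (auto simp: add.commute intro!: sum.cong)
    finally show ?thesis .
  qed
  have shift: "(\<integral>\<^sup>+y. k (t + y) \<partial>lborel) = (\<integral>\<^sup>+y. k y \<partial>lborel)"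
    if [measurable]: "k \<in> borel_measurable borel" for k :: "real \<Rightarrow> ennreal" and t
    by (subst (2) lborel_distr_plus[of t, symmetric]) (simp add: nn_integral_distr)
  have "(\<integral>\<^sup>+x. f (x + (u \<bullet> x) *\<^sub>R b) \<partial>lborel)
      = (\<integral>\<^sup>+g. (\<integral>\<^sup>+y. f (?s g + (u \<bullet> ?s g + y) *\<^sub>R b) \<partial>lborel) \<partial>(\<Pi>\<^sub>M c\<in>?B. lborel))"
    by (subst split) (auto simp: inner_add_right ub scaleR_add_left ac_simps)
  also have "\<dots> = (\<integral>\<^sup>+g. (\<integral>\<^sup>+y. f (?s g + y *\<^sub>R b) \<partial>lborel) \<partial>(\<Pi>\<^sub>M c\<in>?B. lborel))"
    by (intro nn_integral_cong shift[where k = "\<lambda>y. f (_ + y *\<^sub>R b)"]) simp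
  also have "\<dots> = (\<integral>\<^sup>+x. f x \<partial>lborel)" by (rule split[symmetric]) simp
  finally show ?thesis .
qed

lemma pos_def_matrix_diag_pos:
  assumes "pos_def_matrix P" shows "0 < P $ i $ i"
proof -
  have "0 < axis i (1::real) \<bullet> (P *v axis i 1)"
    using assms unfolding pos_def_matrix_def by (simp add: axis_eq_0_iff)
  then show ?thesis by (simp add: matrix_vector_mult_basis column_def inner_axis' )
qed

lemma prod_sqrt: "(\<Prod>i\<in>I. sqrt (f i)) = sqrt (\<Prod>i\<in>I. f i)"
  by (induction I rule: infinite_finite_induct) (auto simp: real_sqrt_mult)

text \<open>A diagonal form is a sum of one-variable terms, so the exponential is a product over the
  coordinates and the integral is a product of one-dimensional normal integrals.\<close>

lemma nn_integral_exp_diagonal_form: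
  fixes P :: "real^'d^'d"
  assumes P: "pos_def_matrix P" and diag: "\<And>i j. i \<noteq> j \<Longrightarrow> P $ i $ j = 0"
  shows "(\<integral>\<^sup>+x. ennreal (exp (- (x \<bullet> (P *v x)) / 2)) \<partial>lborel) = ennreal (sqrt ((2 * pi) ^ CARD('d) / det P))"
proof -
  have p: "0 < P $ i $ i" for i using pos_def_matrix_diag_pos[OF P] .
  define h where "h b y = exp (- ((b \<bullet> (P *v b)) * y\<^sup>2 / 2))" for b :: "real^'d" and y :: real
  have ax: "axis i 1 \<bullet> (P *v axis i 1) = P $ i $ i" for i
    by (simp add: matrix_vector_mult_basis column_def inner_axis')
  have xP: "x \<bullet> axis i 1 = x $ i" for x :: "real^'d" and i
    by (simp add: inner_axis)
  have Pv: "(P *v x) $ i = P $ i $ i * x $ i" for x i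
    unfolding matrix_vector_mult_def using diag by (simp add: sum.remove[of UNIV i])
  have B: "Basis = range (\<lambda>i::'d. axis i (1::real))" by (auto simp: Basis_vec_def)
  have inj: "inj (\<lambda>i::'d. axis i (1::real))" by (auto simp: inj_on_def axis_eq_axis)
  have 1: "exp (- (x \<bullet> (P *v x)) / 2) = (\<Prod>b\<in>Basis. h b (x \<bullet> b))" for x
    unfolding B h_def
    by (subst prod.reindex[OF inj], unfold o_def ax xP)
      (simp add: inner_vec_def Pv exp_sum[symmetric] sum_negf sum_divide_distrib power2_eq_square ac_simps)
  have 2: "(\<integral>\<^sup>+y. ennreal (h b y) \<partial>lborel) = ennreal (sqrt (2 * pi / (b \<bullet> (P *v b))))"
    if bB: "b \<in> Basis" for b
  proof -
    obtain i where b: "b = axis i 1" using bB unfolding B by blast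
    define c where "c = P $ i $ i"
    have c: "0 < c" using p by (simp add: c_def)
    interpret N: prob_space "density lborel (normal_density 0 (1 / sqrt c))"
      by (rule prob_space_normal_density) (use c in simp)
    \<comment> \<open>The factor is a multiple of the normal density of variance
      \<open>1 / c\<close>; since that density has mass 1, the multiple is the integral.\<close>
    have "h b y = sqrt (2 * pi / c) * normal_density 0 (1 / sqrt c) y" for y
      using c by (simp add: h_def b ax c_def[symmetric] normal_density_def power_divide real_sqrt_divide field_simps)
    then have "(\<integral>\<^sup>+y. ennreal (h b y) \<partial>lborel)
        = ennreal (sqrt (2 * pi / c)) * emeasure (density lborel (normal_density 0 (1 / sqrt c))) UNIV"
      using c by (simp add: ennreal_mult nn_integral_cmult emeasure_density)
    then show ?thesis using N.emeasure_space_1 by (simp add: b ax c_def)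
  qed
  have "(\<integral>\<^sup>+x. ennreal (exp (- (x \<bullet> (P *v x)) / 2)) \<partial>lborel)
      = (\<integral>\<^sup>+x. (\<Prod>b\<in>Basis. ennreal (h b (x \<bullet> b))) \<partial>lborel)"
    unfolding 1 by (intro nn_integral_cong prod_ennreal[symmetric]) (simp add: h_def)
  also have "\<dots> = (\<Prod>b\<in>Basis. \<integral>\<^sup>+y. ennreal (h b y) \<partial>lborel)"
    by (rule nn_integral_lborel_prod) (auto simp: h_def)
  also have "\<dots> = (\<Prod>i\<in>UNIV. ennreal (sqrt (2 * pi / P $ i $ i)))"
    using 2 by (simp add: B prod.reindex[OF inj] o_def ax)
  also have "\<dots> = ennreal (\<Prod>i\<in>UNIV. sqrt (2 * pi / P $ i $ i))"
    using p by (subst prod_ennreal) (auto simp: less_imp_le)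
  also have "(\<Prod>i\<in>UNIV. sqrt (2 * pi / P $ i $ i)) = sqrt (\<Prod>i\<in>UNIV. 2 * pi / P $ i $ i)"
    by (rule prod_sqrt)
  also have "(\<Prod>i\<in>UNIV. 2 * pi / P $ i $ i) = (2 * pi) ^ CARD('d) / det P"
    using diag by (subst det_diagonal) (auto simp: prod_dividef)
  finally show ?thesis .
qed

lemma borel_measurable_quadratic_form [measurable]:
  fixes P :: "real^'d^'d"
  shows "(\<lambda>x. x \<bullet> (P *v x)) \<in> borel_measurable borel"
  by (intro borel_measurable_continuous_onI continuous_intros matrix_vector_mult_linear_continuous_on)

text \<open>Symmetric Gaussian elimination: \<open>F\<close> contains the rows that need not be diagonal yet, and each step removes
  one of them by a shear, which has determinant 1 and preserves Lebesgue measure. The linear change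
  of variables of the library is not applicable, since it needs a wellordered index type.\<close>

lemma nn_integral_exp_pos_def_form:
  fixes P :: "real^'d^'d"
  assumes "pos_def_matrix P"
  shows "(\<integral>\<^sup>+x. ennreal (exp (- (x \<bullet> (P *v x)) / 2)) \<partial>lborel) = ennreal (sqrt ((2 * pi) ^ CARD('d) / det P))"
    and "0 < det P"
proof -
  \<comment> \<open>The sign of the determinant is carried through the same induction: each step
    preserves the determinant, and the diagonal case has positive entries.\<close>
  have "(\<integral>\<^sup>+x. ennreal (exp (- (x \<bullet> (P *v x)) / 2)) \<partial>lborel) = ennreal (sqrt ((2 * pi) ^ CARD('d) / det P)) \<and> 0 < det P"
    if "finite F" "pos_def_matrix P" "\<And>i j. i \<notin> F \<Longrightarrow> i \<noteq> j \<Longrightarrow> P $ i $ j = 0"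
    for F and P :: "real^'d^'d"
    using that
  proof (induction F arbitrary: P rule: finite_induct)
    case empty
    then show ?case
      using nn_integral_exp_diagonal_form[of P] det_diagonal[of P] pos_def_matrix_diag_pos[of P]
      by (auto intro!: prod_pos)
  next
    case (insert a F)
    have pa: "0 < P $ a $ a" using insert.prems(1) by (rule pos_def_matrix_diag_pos)
    have sym: "P $ i $ j = P $ j $ i" for i j
      using insert.prems(1) unfolding pos_def_matrix_def by (metis transpose_def vec_lambda_beta)
    \<comment> \<open>This completes the square in the variable \<open>a\<close>: the entries of row
      \<open>a\<close> off the diagonal become
      \<open>P $ a $ j + u $ j * P $ a $ a = 0\<close>.\<close>
    define u where "u = (\<chi> j. if j = a then 0 else - (P $ a $ j / P $ a $ a))"
    \<comment> \<open>The shear as the identity matrix with a combination of the other rows added to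
      row \<open>a\<close>, the shape in which \<open>det_row_span\<close> yields determinant
      1.\<close>
    define A where "A = (\<chi> i. if i = a then row a (mat 1) + u else row i (mat 1 :: real^'d^'d))"
    have ua: "u \<bullet> axis a 1 = 0" by (simp add: u_def inner_axis)
    have A: "A *v x = x + (u \<bullet> x) *\<^sub>R axis a 1" for x
      by (auto simp: A_def vec_eq_iff matrix_vector_mult_def row_def mat_def axis_def inner_vec_def
          distrib_right sum.distrib if_distrib[of "\<lambda>x. x * _"] cong: if_cong)
    have "u \<in> vec.span {row j (mat 1 :: real^'d^'d) |j. j \<noteq> a}"
    proof -
      have "u = (\<Sum>j\<in>-{a}. (u $ j) *s row j (mat 1 :: real^'d^'d))"
        using ua by (auto simp: vec_eq_iff row_def mat_def inner_axis if_distrib[of "\<lambda>x. _ * x"] cong: if_cong)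
      also have "\<dots> \<in> vec.span {row j (mat 1 :: real^'d^'d) |j. j \<noteq> a}"
        by (intro vec.span_sum vec.span_scale vec.span_base) auto
      finally show ?thesis .
    qed
    then have detA: "det A = 1"
      unfolding A_def by (subst det_row_span) auto
    define Q where "Q = transpose A ** P ** A"
    have Qx: "x \<bullet> (Q *v y) = (A *v x) \<bullet> (P *v (A *v y))" for x y
    proof -
      have "x \<bullet> (transpose A *v z) = (A *v x) \<bullet> z" for z
        using dot_lmul_matrix[of z A x] by (simp add: inner_commute)
      then show ?thesis by (simp add: Q_def matrix_vector_mul_assoc[symmetric])
    qed
    have detQ: "det Q = det P" by (simp add: Q_def det_mul det_transpose detA)
    have Qij: "Q $ i $ j = P $ i $ j + u $ i * P $ a $ j + u $ j * P $ i $ a + u $ i * u $ j * P $ a $ a" for i j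
    proof -
      have "Q $ i $ j = axis i 1 \<bullet> (Q *v axis j 1)"
        by (simp add: matrix_vector_mult_basis column_def inner_axis')
      also have "\<dots> = (axis i 1 + u $ i *\<^sub>R axis a 1) \<bullet> (P *v (axis j 1 + u $ j *\<^sub>R axis a 1))"
        by (simp add: Qx A inner_axis)
      also have "\<dots> = P $ i $ j + u $ i * P $ a $ j + u $ j * P $ i $ a + u $ i * u $ j * P $ a $ a"
        by (simp add: inner_add_left inner_axis' matrix_vector_right_distrib
            matrix_vector_mult_scaleR matrix_vector_mult_basis column_def algebra_simps)
      finally show ?thesis .
    qed
    have A0: "A *v x \<noteq> 0" if "x \<noteq> 0" for x
    proof
      assume "A *v x = 0"
      moreover have "invertible A" using detA by (simp add: invertible_det_nz)
      ultimately show False using that by (metis invertible_def matrix_vector_mul_assoc matrix_vector_mul_lid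
            matrix_vector_mult_0_right)
    qed
    have pdQ: "pos_def_matrix Q"
      unfolding pos_def_matrix_def
    proof (intro conjI allI impI)
      show "transpose Q = Q"
        using insert.prems(1) by (simp add: Q_def matrix_transpose_mul matrix_mul_assoc pos_def_matrix_def)
      show "0 < x \<bullet> (Q *v x)" if "x \<noteq> 0" for x
        using insert.prems(1) A0[OF that] by (simp add: Qx pos_def_matrix_def)
    qed
    \<comment> \<open>Row \<open>a\<close> is cleared by the choice of \<open>u\<close>. A row that
      was already diagonal has entry 0 in column \<open>a\<close>, hence by symmetry
      \<open>u $ i = 0\<close>, and it stays as it is.\<close>
    have offQ: "Q $ i $ j = 0" if "i \<notin> F" "i \<noteq> j" for i j
    proof (cases "i = a")
      case True
      then show ?thesis using that pa by (simp add: Qij u_def)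
    next
      case False
      then have "P $ i $ j = 0" "P $ i $ a = 0" using insert.prems(2)[of i] that by auto
      then show ?thesis using False sym[of a i] by (simp add: Qij u_def)
    qed
    have "(\<integral>\<^sup>+x. ennreal (exp (- (x \<bullet> (P *v x)) / 2)) \<partial>lborel)
        = (\<integral>\<^sup>+x. ennreal (exp (- (x \<bullet> (Q *v x)) / 2)) \<partial>lborel)"
      unfolding Qx A
      by (rule nn_integral_lborel_shear[symmetric]) (use ua in \<open>auto simp: Basis_vec_def\<close>)
    then show ?case using insert.IH[OF pdQ offQ] detQ by simp
  qed
  \<comment> \<open>For \<open>F = UNIV\<close> the condition on the rows is vacuous.\<close>
  from this[of UNIV P] assms
  show "(\<integral>\<^sup>+x. ennreal (exp (- (x \<bullet> (P *v x)) / 2)) \<partial>lborel) = ennreal (sqrt ((2 * pi) ^ CARD('d) / det P))"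
    and "0 < det P" by simp_all
qed

section \<open>Inverse covariances and the Gaussian density\<close>

lemma pos_def_matrix_invertible:
  assumes "pos_def_matrix C" shows "invertible C"
  using nn_integral_exp_pos_def_form[OF assms] by (simp add: invertible_det_nz)

lemma matrix_inv_mul:
  fixes C :: "real^'d^'d"
  assumes "invertible C" shows "C ** matrix_inv C = mat 1" "matrix_inv C ** C = mat 1"
  using someI_ex[OF assms[unfolded invertible_def]] by (simp_all add: matrix_inv_def)

text \<open>The transpose of the inverse is again an inverse of the symmetric \<open>C\<close>,
  which gives symmetry. For positivity, the form of the inverse at \<open>x\<close> is the form of
  \<open>C\<close> at \<open>matrix_inv C *v x\<close>.\<close>

lemma pos_def_matrix_inv:
  fixes C :: "real^'d^'d"
  assumes C: "pos_def_matrix C"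
  shows "pos_def_matrix (matrix_inv C)"
proof -
  note inv = matrix_inv_mul[OF pos_def_matrix_invertible[OF C]]
  let ?P = "matrix_inv C"
  have sC: "transpose C = C" using C by (simp add: pos_def_matrix_def)
  have "transpose ?P ** C = mat 1"
    using arg_cong[OF inv(1), of transpose] by (simp add: matrix_transpose_mul sC transpose_mat)
  then have "transpose ?P = ?P"
    by (metis inv(1) matrix_mul_assoc matrix_mul_lid matrix_mul_rid)
  moreover have "0 < x \<bullet> (?P *v x)" if "x \<noteq> 0" for x
  proof -
    have x: "C *v (?P *v x) = x" by (simp add: matrix_vector_mul_assoc inv)
    then have "?P *v x \<noteq> 0" using that by auto
    then have "0 < (?P *v x) \<bullet> (C *v (?P *v x))" using C unfolding pos_def_matrix_def by blast
    then show ?thesis by (simp add: x inner_commute)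
  qed
  ultimately show ?thesis by (simp add: pos_def_matrix_def)
qed

lemma det_matrix_inv_pos_def:
  fixes C :: "real^'d^'d"
  assumes C: "pos_def_matrix C"
  shows "det (matrix_inv C) = 1 / det C" "0 < det C"
proof -
  show "0 < det C" using nn_integral_exp_pos_def_form[OF C] by simp
  then show "det (matrix_inv C) = 1 / det C"
    using arg_cong[OF matrix_inv_mul(1)[OF pos_def_matrix_invertible[OF C]], of det]
    by (simp add: det_mul det_I field_simps)
qed

lemma gaussian_density_pos:
  assumes "pos_def_matrix C" shows "0 < gaussian_density m C x"
  using det_matrix_inv_pos_def(2)[OF assms] by (simp add: gaussian_density_def)

lemma borel_measurable_gaussian_density [measurable]:
  fixes C :: "real^'d^'d"
  shows "gaussian_density m C \<in> borel_measurable borel"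
proof -
  have [measurable]: "(\<lambda>x. (x - m) \<bullet> (matrix_inv C *v (x - m))) \<in> borel_measurable borel"
    by (rule measurable_compose[OF _ borel_measurable_quadratic_form]) simp
  show ?thesis unfolding gaussian_density_def[abs_def] by measurable
qed

lemma sets_gaussian [measurable_cong, simp]: "sets (gaussian m C) = sets borel"
  by (simp add: gaussian_def)

lemma space_gaussian [simp]: "space (gaussian m C) = UNIV"
  by (simp add: gaussian_def)

text \<open>The integral formula is applied to the inverse matrix, whose determinant is
  \<open>1 / det C\<close>; this produces exactly the normalizing constant.\<close>

lemma nn_integral_gaussian_density_0:
  fixes C :: "real^'d^'d"
  assumes C: "pos_def_matrix C"
  shows "(\<integral>\<^sup>+x. ennreal (gaussian_density 0 C x) \<partial>lborel) = 1"
proof -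
  have d: "0 < det C" using det_matrix_inv_pos_def[OF C] by simp
  let ?K = "sqrt ((2 * pi) ^ CARD('d) * det C)"
  have K: "0 < ?K" using d by simp
  have "(\<integral>\<^sup>+x. ennreal (gaussian_density 0 C x) \<partial>lborel)
      = (\<integral>\<^sup>+x. ennreal (1 / ?K) * ennreal (exp (- (x \<bullet> (matrix_inv C *v x)) / 2)) \<partial>lborel)"
    using K by (intro nn_integral_cong) (simp add: gaussian_density_def ennreal_mult[symmetric])
  also have "\<dots> = ennreal (1 / ?K) * ennreal ?K"
    using nn_integral_exp_pos_def_form[OF pos_def_matrix_inv[OF C]] det_matrix_inv_pos_def[OF C]
    by (subst nn_integral_cmult) (auto simp: borel_measurable_quadratic_form)
  also have "\<dots> = 1" using K d by (simp add: ennreal_mult[symmetric])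
  finally show ?thesis .
qed

lemma prob_space_gaussian_0:
  assumes "pos_def_matrix C" shows "prob_space (gaussian 0 C)"
  by (rule prob_spaceI) (simp add: gaussian_def emeasure_density nn_integral_gaussian_density_0[OF assms])

section \<open>Scaling, full support and first moment of Gaussians\<close>

lemma scaleR_matrix_matrix: "mat c ** A = c *\<^sub>R (A :: real^'n^'m)"
  by (simp add: vec_eq_iff matrix_matrix_mult_def mat_def if_distrib[of "\<lambda>x. x * _"] cong: if_cong)

text \<open>This is what makes the coupling possible: the laws for all finite \<kappa> are affine
  images of a single Gaussian. The Jacobian of the affine map cancels against the change of the
  determinant in the normalizing constant.\<close>

lemma gaussian_scale:
  fixes C :: "real^'d^'d"
  assumes C: "pos_def_matrix C" and r: "0 < r"
  shows "gaussian m (inverse r *\<^sub>R C) = distr (gaussian 0 C) borel (\<lambda>x. m + (1 / sqrt r) *\<^sub>R x)"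
proof -
  let ?s = "1 / sqrt r" and ?T = "\<lambda>x::real^'d. m + (1 / sqrt r) *\<^sub>R x"
  have s: "0 < ?s" using r by simp
  note inv = matrix_inv_mul[OF pos_def_matrix_invertible[OF C]]
  have "(inverse r *\<^sub>R C) ** (r *\<^sub>R matrix_inv C) = mat 1"
    using r by (simp add: scalar_matrix_assoc matrix_scalar_ac inv flip: scalar_mult_eq_scaleR)
  then have iC: "matrix_inv (inverse r *\<^sub>R C) = r *\<^sub>R matrix_inv C"
    by (metis invertible_right_inverse matrix_inv_mul(2) matrix_mul_assoc matrix_mul_lid matrix_mul_rid)
  have dC: "det (inverse r *\<^sub>R C) = inverse r ^ CARD('d) * det C"
  proof -
    \<comment> \<open>Scaling is written as a matrix product so that multiplicativity of the
      determinant applies.\<close>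
    have "inverse r *\<^sub>R C = matrix ((*\<^sub>R) (inverse r)) ** C"
      by (simp add: matrix_scaleR scaleR_matrix_matrix)
    then show ?thesis by (simp only: det_mul det_matrix_scaleR)
  qed
  have "gaussian_density m (inverse r *\<^sub>R C) (?T x) * \<bar>?s\<bar> ^ CARD('d) = gaussian_density 0 C x" for x
  proof -
    have "sqrt ((2 * pi) ^ CARD('d) * det (inverse r *\<^sub>R C)) = ?s ^ CARD('d) * sqrt ((2 * pi) ^ CARD('d) * det C)"
      unfolding dC using r by (simp add: real_sqrt_mult real_sqrt_power real_sqrt_inverse real_sqrt_divide field_simps)
    then show ?thesis
      using r by (simp add: gaussian_density_def iC scaleR_matrix_vector_assoc[symmetric] matrix_vector_mult_scaleR)
  qed
  then have "distr (density lborel (\<lambda>x. ennreal (gaussian_density 0 C x))) borel ?T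
      = distr (density lborel (\<lambda>x. ennreal (gaussian_density m (inverse r *\<^sub>R C) (?T x)) * ennreal (\<bar>?s\<bar> ^ CARD('d)))) borel ?T"
    using r by (simp add: ennreal_mult''[symmetric])
  also have "\<dots> = density (distr lborel borel ?T) (\<lambda>x. ennreal (gaussian_density m (inverse r *\<^sub>R C) x) * ennreal (\<bar>?s\<bar> ^ CARD('d)))"
    by (rule density_distr[symmetric]) auto
  also have "\<dots> = density (density (distr lborel borel ?T) (\<lambda>_. ennreal (\<bar>?s\<bar> ^ CARD('d)))) (\<lambda>x. ennreal (gaussian_density m (inverse r *\<^sub>R C) x))"
    by (subst density_density_eq) (auto simp: mult.commute)
  also have "density (distr lborel borel ?T) (\<lambda>_. ennreal (\<bar>?s\<bar> ^ CARD('d))) = lborel"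
    using lborel_affine[of ?s m] s by (simp add: ennreal_power)
  finally show ?thesis by (simp add: gaussian_def)
qed

text \<open>The density is positive everywhere, so a Gaussian null set is a Lebesgue null set, and a
  nonempty open set is not one.\<close>

lemma emeasure_gaussian_open_pos:
  fixes C :: "real^'d^'d"
  assumes C: "pos_def_matrix C" and U: "open U" "U \<noteq> {}"
  shows "0 < emeasure (gaussian m C) U"
proof -
  have "U \<notin> null_sets (gaussian m C)"
  proof
    assume "U \<in> null_sets (gaussian m C)"
    then have "AE x in lborel. x \<notin> U"
      using gaussian_density_pos[OF C, of m] U
      by (auto simp: gaussian_def null_sets_density_iff ennreal_eq_0_iff not_le[symmetric])
    then have "U \<in> null_sets lborel" using U by (simp add: AE_iff_null_sets)
    then have "negligible U" by (simp add: negligible_iff_null_sets null_sets_completionI)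
    then show False using U open_not_negligible by blast
  qed
  then show ?thesis using U by (simp add: null_sets_def zero_less_iff_neq_zero)
qed

text \<open>The form attains a positive minimum on the compact unit sphere, and it is homogeneous of
  degree 2.\<close>

lemma pos_def_matrix_coercive:
  fixes P :: "real^'d^'d"
  assumes P: "pos_def_matrix P"
  obtains c where "0 < c" "\<And>x. c * (norm x)\<^sup>2 \<le> x \<bullet> (P *v x)"
proof -
  have cont: "continuous_on (sphere 0 1) (\<lambda>x. x \<bullet> (P *v x))"
    by (intro continuous_intros matrix_vector_mult_linear_continuous_on)
  have "axis undefined 1 \<in> sphere (0 :: real^'d) 1" by simp
  then obtain x0 where x0: "x0 \<in> sphere 0 1" "\<And>x. x \<in> sphere 0 1 \<Longrightarrow> x0 \<bullet> (P *v x0) \<le> x \<bullet> (P *v x)"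
    using continuous_attains_inf[OF compact_sphere _ cont] by auto
  show ?thesis
  proof
    show "0 < x0 \<bullet> (P *v x0)" using P x0(1) unfolding pos_def_matrix_def by (metis norm_zero mem_sphere_0 zero_neq_one)
    fix x :: "real^'d"
    show "(x0 \<bullet> (P *v x0)) * (norm x)\<^sup>2 \<le> x \<bullet> (P *v x)"
    proof (cases "x = 0")
      case False
      have "x0 \<bullet> (P *v x0) \<le> (x /\<^sub>R norm x) \<bullet> (P *v (x /\<^sub>R norm x))"
        by (rule x0(2)) (use False in simp)
      also have "\<dots> = (x \<bullet> (P *v x)) / (norm x)\<^sup>2"
        by (simp add: matrix_vector_mult_scaleR power2_eq_square field_simps)
      finally show ?thesis using False by (simp add: field_simps)
    qed simp
  qed
qed

text \<open>Half of the exponent absorbs the factor \<open>norm x\<close>; the other half is again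
  the exponential of a negative definite form, so it is integrable.\<close>

lemma integrable_norm_gaussian_0:
  fixes C :: "real^'d^'d"
  assumes C: "pos_def_matrix C"
  shows "integrable (gaussian 0 C) norm"
proof -
  let ?P = "matrix_inv C" and ?K = "sqrt ((2 * pi) ^ CARD('d) * det C)"
  let ?H = "(1 / 2) *\<^sub>R ?P"
  have K: "0 < ?K" using det_matrix_inv_pos_def[OF C] by simp
  have P: "pos_def_matrix ?P" by (rule pos_def_matrix_inv[OF C])
  then have H: "pos_def_matrix ?H"
    by (simp add: pos_def_matrix_def transpose_scalar scaleR_matrix_vector_assoc[symmetric])
  have q: "x \<bullet> (?H *v x) = x \<bullet> (?P *v x) / 2" for x
    by (simp add: scaleR_matrix_vector_assoc[symmetric])
  obtain c where c: "0 < c" "\<And>x. c * (norm x)\<^sup>2 \<le> x \<bullet> (?P *v x)"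
    using pos_def_matrix_coercive[OF P] by blast
  \<comment> \<open>The constant comes from \<open>norm x \<le> 1 + (norm x)\<^sup>2\<close> and
    \<open>1 + t \<le> (1 + 4 / c) * (1 + c * t / 4)\<close> for nonnegative \<open>t\<close>,
    followed by \<open>1 + z \<le> exp z\<close>.\<close>
  have bound: "norm x * exp (- (x \<bullet> (?P *v x)) / 2) \<le> (1 + 4 / c) * exp (- (x \<bullet> (?H *v x)) / 2)" for x
  proof -
    let ?q = "x \<bullet> (?P *v x)"
    have "norm x \<le> 1 + (norm x)\<^sup>2"
      using sum_squares_bound[of 1 "norm x"] zero_le_power2[of "norm x"] norm_ge_zero[of x] unfolding one_power2 by linarith
    also have "\<dots> \<le> (1 + 4 / c) * (1 + c * (norm x)\<^sup>2 / 4)"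
      using c(1) by (simp add: field_simps add_nonneg_nonneg)
    also have "\<dots> \<le> (1 + 4 / c) * exp (?q / 4)"
    proof (rule mult_left_mono)
      show "1 + c * (norm x)\<^sup>2 / 4 \<le> exp (?q / 4)"
        using exp_ge_add_one_self[of "?q / 4"] c(2)[of x] by linarith
    qed (use c in simp)
    finally have "norm x * exp (- ?q / 2) \<le> (1 + 4 / c) * exp (?q / 4) * exp (- ?q / 2)"
      by (intro mult_right_mono) auto
    also have "\<dots> = (1 + 4 / c) * exp (- (x \<bullet> (?H *v x)) / 2)"
      by (simp add: q mult.assoc exp_add[symmetric])
    finally show ?thesis .
  qed
  have "integrable lborel (\<lambda>x. exp (- (x \<bullet> (?H *v x)) / 2))"
    using nn_integral_exp_pos_def_form[OF H] by (intro integrableI_nonneg) auto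
  then have "integrable lborel (\<lambda>x. (1 + 4 / c) / ?K * exp (- (x \<bullet> (?H *v x)) / 2))"
    by (rule integrable_mult_right)
  then have "integrable lborel (\<lambda>x. gaussian_density 0 C x *\<^sub>R norm x)"
  proof (rule Bochner_Integration.integrable_bound)
    show "AE x in lborel. norm (gaussian_density 0 C x *\<^sub>R norm x)
        \<le> norm ((1 + 4 / c) / ?K * exp (- (x \<bullet> (?H *v x)) / 2))"
    proof (rule AE_I2)
      fix x
      have "norm (gaussian_density 0 C x *\<^sub>R norm x) = norm x * exp (- (x \<bullet> (?P *v x)) / 2) / ?K"
        using K by (simp add: gaussian_density_def abs_mult)
      also have "\<dots> \<le> (1 + 4 / c) * exp (- (x \<bullet> (?H *v x)) / 2) / ?K"
        using bound K by (intro divide_right_mono) auto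
      also have "\<dots> \<le> norm ((1 + 4 / c) / ?K * exp (- (x \<bullet> (?H *v x)) / 2))"
        by (simp add: abs_if)
      finally show "norm (gaussian_density 0 C x *\<^sub>R norm x)
        \<le> norm ((1 + 4 / c) / ?K * exp (- (x \<bullet> (?H *v x)) / 2))" .
    qed
  qed simp
  then show ?thesis
    unfolding gaussian_def using gaussian_density_pos[OF C, of 0]
    by (subst integrable_density) (auto simp: less_imp_le)
qed

section \<open>Risk minimization with soft labels\<close>

lemma logistic_loss_pos: "0 < logistic_loss z"
  unfolding logistic_loss_def by (rule ln_gt_zero) simp

text \<open>The Lipschitz half is the logarithm of
  \<open>1 + exp (- a) \<le> exp (b - a) * (1 + exp (- b))\<close>, which holds because
  \<open>exp (b - a) \<ge> 1\<close>.\<close>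

lemma logistic_loss_diff_le:
  assumes "a \<le> b"
  shows "logistic_loss b \<le> logistic_loss a" "logistic_loss a - logistic_loss b \<le> b - a"
proof -
  have pos: "0 < 1 + exp (- x)" for x :: real by (simp add: add_pos_pos)
  show "logistic_loss b \<le> logistic_loss a"
    using assms pos by (simp add: logistic_loss_def)
  have "1 + exp (- a) \<le> exp (b - a) * (1 + exp (- b))"
    using assms by (simp add: distrib_left exp_add[symmetric])
  then have "ln (1 + exp (- a)) \<le> ln (exp (b - a) * (1 + exp (- b)))"
    using pos by (subst ln_le_cancel_iff) (auto intro!: mult_pos_pos)
  also have "\<dots> = (b - a) + ln (1 + exp (- b))" using pos by (subst ln_mult_pos) auto
  finally show "logistic_loss a - logistic_loss b \<le> b - a" by (simp add: logistic_loss_def)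
qed

lemma logistic_loss_lipschitz: "\<bar>logistic_loss a - logistic_loss b\<bar> \<le> \<bar>a - b\<bar>"
  using logistic_loss_diff_le[of a b] logistic_loss_diff_le[of b a] by (cases "a \<le> b") auto

lemma logistic_loss_ge: "max 0 (- z) \<le> logistic_loss z"
proof -
  have "- z = ln (exp (- z))" by simp
  also have "\<dots> \<le> logistic_loss z" unfolding logistic_loss_def by (subst ln_le_cancel_iff) (auto intro: add_pos_pos)
  finally show ?thesis using logistic_loss_pos[of z] by simp
qed

text \<open>With \<open>u = exp (- a / 2)\<close> and \<open>v = exp (- b / 2)\<close> the claim is
  the logarithm of \<open>(1 + u * v)\<^sup>2 < (1 + u\<^sup>2) * (1 + v\<^sup>2)\<close>, and the
  two sides differ by \<open>(u - v)\<^sup>2\<close>.\<close>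

lemma logistic_loss_midpoint_less:
  assumes "a \<noteq> b"
  shows "2 * logistic_loss ((a + b) / 2) < logistic_loss a + logistic_loss b"
proof -
  define u v where "u = exp (- a / 2)" and "v = exp (- b / 2)"
  have uv: "0 < u" "0 < v" "u \<noteq> v" using assms by (auto simp: u_def v_def)
  have e: "exp (- a) = u\<^sup>2" "exp (- b) = v\<^sup>2" "exp (- ((a + b) / 2)) = u * v"
    by (simp_all add: u_def v_def power2_eq_square exp_add[symmetric] field_simps)
  have p: "0 < 1 + u * v" "0 < 1 + u\<^sup>2" "0 < 1 + v\<^sup>2" using uv by (auto intro!: add_pos_pos)
  have "0 < (u - v)\<^sup>2" using uv by simp
  then have "(1 + u * v) ^ 2 < (1 + u\<^sup>2) * (1 + v\<^sup>2)"
    by (simp add: power2_eq_square algebra_simps)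
  then have "ln ((1 + u * v) ^ 2) < ln ((1 + u\<^sup>2) * (1 + v\<^sup>2))"
    using p by (subst ln_less_cancel_iff) auto
  then show ?thesis
    using p by (simp add: logistic_loss_def e ln_realpow ln_mult_pos)
qed

lemma logistic_loss_midpoint_le: "2 * logistic_loss ((a + b) / 2) \<le> logistic_loss a + logistic_loss b"
  using logistic_loss_midpoint_less[of a b] by (cases "a = b") auto

lemma borel_measurable_logistic_loss [measurable]: "logistic_loss \<in> borel_measurable borel"
  unfolding logistic_loss_def[abs_def] by measurable

text \<open>The summand of \<open>mask_loss\<close> as a function of the mixed label
  \<open>a\<close> and the score \<open>z\<close>.\<close>

definition soft_loss :: "real \<Rightarrow> real \<Rightarrow> real" where
  "soft_loss a z = a * logistic_loss z + (1 - a) * logistic_loss (- z)"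

lemma borel_measurable_soft_loss [measurable (raw)]:
  assumes [measurable]: "f \<in> borel_measurable M" "g \<in> borel_measurable M"
  shows "(\<lambda>x. soft_loss (f x) (g x)) \<in> borel_measurable M"
  unfolding soft_loss_def by measurable

lemma soft_loss_lipschitz:
  assumes "0 \<le> a" "a \<le> 1"
  shows "\<bar>soft_loss a y - soft_loss a z\<bar> \<le> \<bar>y - z\<bar>"
proof -
  have "soft_loss a y - soft_loss a z
      = a * (logistic_loss y - logistic_loss z) + (1 - a) * (logistic_loss (- y) - logistic_loss (- z))"
    by (simp add: soft_loss_def algebra_simps)
  also have "\<bar>\<dots>\<bar> \<le> a * \<bar>logistic_loss y - logistic_loss z\<bar> + (1 - a) * \<bar>logistic_loss (- y) - logistic_loss (- z)\<bar>"
    using assms by (intro order_trans[OF abs_triangle_ineq]) (simp add: abs_mult)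
  also have "\<dots> \<le> a * \<bar>y - z\<bar> + (1 - a) * \<bar>y - z\<bar>"
    using assms logistic_loss_lipschitz[of y z] logistic_loss_lipschitz[of "- y" "- z"]
    by (intro add_mono mult_left_mono) auto
  finally show ?thesis by (simp add: algebra_simps)
qed

lemma soft_loss_0: "soft_loss a 0 = ln 2"
  by (simp add: soft_loss_def logistic_loss_def algebra_simps)

text \<open>The weights \<open>a\<close> and \<open>1 - a\<close> are nonnegative and one of them is
  positive; the logistic term with positive weight supplies strictness.\<close>

lemma soft_loss_midpoint:
  assumes "0 \<le> a" "a \<le> 1"
  shows "2 * soft_loss a ((y + z) / 2) \<le> soft_loss a y + soft_loss a z"
    and "y \<noteq> z \<Longrightarrow> 2 * soft_loss a ((y + z) / 2) < soft_loss a y + soft_loss a z"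
proof -
  let ?l = logistic_loss
  have eq: "2 * soft_loss a ((y + z) / 2)
      = a * (2 * ?l ((y + z) / 2)) + (1 - a) * (2 * ?l ((- y + - z) / 2))"
  proof -
    have "(- y + - z) / 2 = - ((y + z) / 2)" by (simp add: field_simps)
    then show ?thesis by (simp only: soft_loss_def distrib_left mult.left_commute)
  qed
  have eq': "soft_loss a y + soft_loss a z = a * (?l y + ?l z) + (1 - a) * (?l (- y) + ?l (- z))"
    by (simp add: soft_loss_def algebra_simps)
  show "2 * soft_loss a ((y + z) / 2) \<le> soft_loss a y + soft_loss a z"
    unfolding eq eq' using assms by (intro add_mono mult_left_mono logistic_loss_midpoint_le) auto
  assume ne: "y \<noteq> z"
  show "2 * soft_loss a ((y + z) / 2) < soft_loss a y + soft_loss a z"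
  proof (cases "a = 0")
    case True
    then show ?thesis unfolding eq eq' using logistic_loss_midpoint_less[of "- y" "- z"] ne by simp
  next
    case False
    then show ?thesis unfolding eq eq' using assms ne
      by (intro add_less_le_mono mult_left_mono mult_strict_left_mono logistic_loss_midpoint_le logistic_loss_midpoint_less) auto
  qed
qed

section \<open>The homogeneous lower bound of the soft loss\<close>

text \<open>The recession function of the soft loss: \<open>soft_loss a (t * z) / t\<close> tends to
  \<open>hinge a z\<close> as \<open>t\<close> grows. It is zero exactly when no label of positive
  weight is contradicted by the sign of \<open>z\<close>, for \<open>a\<close> between 0 and
  1.\<close>

definition hinge :: "real \<Rightarrow> real \<Rightarrow> real" where
  "hinge a z = a * max 0 (- z) + (1 - a) * max 0 z"

lemma borel_measurable_hinge [measurable (raw)]: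
  assumes [measurable]: "f \<in> borel_measurable M" "g \<in> borel_measurable M"
  shows "(\<lambda>x. hinge (f x) (g x)) \<in> borel_measurable M"
  unfolding hinge_def by measurable

lemma hinge_bounds:
  assumes "0 \<le> a" "a \<le> 1"
  shows "0 \<le> hinge a z" "hinge a z \<le> \<bar>z\<bar>" "hinge a z \<le> soft_loss a z"
    "\<bar>hinge a y - hinge a z\<bar> \<le> \<bar>y - z\<bar>"
proof -
  show nonneg: "0 \<le> hinge a z" using assms by (simp add: hinge_def)
  show "hinge a z \<le> soft_loss a z"
    unfolding hinge_def soft_loss_def
    using assms logistic_loss_ge[of z] logistic_loss_ge[of "- z"] by (intro add_mono mult_left_mono) auto
  have lip: "\<bar>hinge a y - hinge a z\<bar> \<le> \<bar>y - z\<bar>" for y z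
  proof -
    have "hinge a y - hinge a z = a * (max 0 (- y) - max 0 (- z)) + (1 - a) * (max 0 y - max 0 z)"
      by (simp add: hinge_def algebra_simps)
    also have "\<bar>\<dots>\<bar> \<le> a * \<bar>max 0 (- y) - max 0 (- z)\<bar> + (1 - a) * \<bar>max 0 y - max 0 z\<bar>"
      using assms by (intro order_trans[OF abs_triangle_ineq]) (simp add: abs_mult)
    also have "\<dots> \<le> a * \<bar>y - z\<bar> + (1 - a) * \<bar>y - z\<bar>"
      using assms by (intro add_mono mult_left_mono) auto
    finally show ?thesis by (simp add: algebra_simps)
  qed
  then show "\<bar>hinge a y - hinge a z\<bar> \<le> \<bar>y - z\<bar>" .
  show "hinge a z \<le> \<bar>z\<bar>" using lip[of z 0] nonneg by (simp add: hinge_def)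
qed

lemma hinge_pos:
  shows "0 < a \<Longrightarrow> z < 0 \<Longrightarrow> 0 < hinge a z" and "a < 1 \<Longrightarrow> 0 < z \<Longrightarrow> 0 < hinge a z"
  by (simp_all add: hinge_def mult_pos_neg)

lemma hinge_scale:
  assumes "0 \<le> t" shows "hinge a (t * z) = t * hinge a z"
proof -
  have max: "max 0 (t * y) = t * max 0 y" for y
    using assms mult_nonneg_nonneg[of t y] mult_nonneg_nonpos[of t y] by (cases "0 \<le> y") (auto simp: max_absorb1 max_absorb2)
  show ?thesis using max[of z] max[of "- z"] by (simp add: hinge_def algebra_simps)
qed

section \<open>Existence and uniqueness of the risk minimizer\<close>

text \<open>Abstracts the expected loss at one noise level: \<open>k\<close> ranges over the pairs
  of sample indices, \<open>A k\<close> is the mixed label and \<open>X k\<close> the mixed point.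
  The condition \<open>nondegenerate\<close> is used twice, at \<open>w\<close> for coercivity and
  at a difference \<open>v - w\<close> for strict convexity.\<close>

locale soft_classifier = prob_space P for P :: "'a measure" +
  fixes K :: "'k set" and c :: real and A :: "'k \<Rightarrow> 'a \<Rightarrow> real" and X :: "'k \<Rightarrow> 'a \<Rightarrow> 'b::euclidean_space"
  assumes finite_K: "finite K" and c_pos: "0 < c"
    and A_meas [measurable]: "\<And>k. k \<in> K \<Longrightarrow> A k \<in> borel_measurable P"
    and A_bounds: "\<And>k. k \<in> K \<Longrightarrow> AE \<omega> in P. 0 \<le> A k \<omega> \<and> A k \<omega> \<le> 1"
    and X_int: "\<And>k. k \<in> K \<Longrightarrow> integrable P (X k)"
    and nondegenerate: "\<And>w. w \<noteq> 0 \<Longrightarrow> \<exists>k\<in>K. \<not> (AE \<omega> in P. hinge (A k \<omega>) (w \<bullet> X k \<omega>) = 0)"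
begin

definition risk :: "'b \<Rightarrow> real" where
  "risk w = c * (\<Sum>k\<in>K. \<integral>\<omega>. soft_loss (A k \<omega>) (w \<bullet> X k \<omega>) \<partial>P)"

lemma X_meas [measurable]: "k \<in> K \<Longrightarrow> X k \<in> borel_measurable P"
  using X_int by auto

lemma integrable_soft_loss:
  assumes k: "k \<in> K" shows "integrable P (\<lambda>\<omega>. soft_loss (A k \<omega>) (w \<bullet> X k \<omega>))"
proof (rule Bochner_Integration.integrable_bound)
  show "integrable P (\<lambda>\<omega>. ln 2 + \<bar>w \<bullet> X k \<omega>\<bar>)"
    by (intro Bochner_Integration.integrable_add integrable_abs integrable_inner_right X_int k integrable_const)
  show "AE \<omega> in P. norm (soft_loss (A k \<omega>) (w \<bullet> X k \<omega>)) \<le> norm (ln 2 + \<bar>w \<bullet> X k \<omega>\<bar>)"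
    using A_bounds[OF k]
  proof eventually_elim
    case (elim \<omega>)
    then have "\<bar>soft_loss (A k \<omega>) (w \<bullet> X k \<omega>) - ln 2\<bar> \<le> \<bar>w \<bullet> X k \<omega>\<bar>"
      using soft_loss_lipschitz[of "A k \<omega>" "w \<bullet> X k \<omega>" 0] by (simp add: soft_loss_0)
    moreover have "0 \<le> ln (2 :: real)" by simp
    ultimately show ?case unfolding real_norm_def by linarith
  qed
qed (use k in measurable)

lemma integrable_hinge:
  assumes k: "k \<in> K" shows "integrable P (\<lambda>\<omega>. hinge (A k \<omega>) (w \<bullet> X k \<omega>))"
proof (rule Bochner_Integration.integrable_bound)
  show "integrable P (\<lambda>\<omega>. w \<bullet> X k \<omega>)"
    by (intro integrable_inner_right X_int k)
  show "AE \<omega> in P. norm (hinge (A k \<omega>) (w \<bullet> X k \<omega>)) \<le> norm (w \<bullet> X k \<omega>)"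
    using A_bounds[OF k] by eventually_elim (use hinge_bounds in auto)
qed (use k in measurable)

text \<open>Stated for an arbitrary loss that is 1-Lipschitz in the score, so that it covers both
  \<open>soft_loss\<close> and \<open>hinge\<close>. The expected norm of \<open>X k\<close> is a
  Lipschitz constant of the integral.\<close>

lemma integral_inner_lipschitz:
  assumes k: "k \<in> K"
    and f: "\<And>a y z. 0 \<le> a \<Longrightarrow> a \<le> 1 \<Longrightarrow> \<bar>f a y - f a z\<bar> \<le> \<bar>y - z :: real\<bar>"
    and int: "\<And>w. integrable P (\<lambda>\<omega>. f (A k \<omega>) (w \<bullet> X k \<omega>) :: real)"
  shows "continuous_on UNIV (\<lambda>w. \<integral>\<omega>. f (A k \<omega>) (w \<bullet> X k \<omega>) \<partial>P)"
proof -
  let ?J = "\<lambda>w. \<integral>\<omega>. f (A k \<omega>) (w \<bullet> X k \<omega>) \<partial>P" and ?L = "\<integral>\<omega>. norm (X k \<omega>) \<partial>P"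
  have "\<bar>?J v - ?J w\<bar> \<le> ?L * norm (v - w)" for v w
  proof -
    have "\<bar>?J v - ?J w\<bar> = norm (\<integral>\<omega>. f (A k \<omega>) (v \<bullet> X k \<omega>) - f (A k \<omega>) (w \<bullet> X k \<omega>) \<partial>P)"
      by (subst Bochner_Integration.integral_diff[OF int int]) simp
    also have "\<dots> \<le> (\<integral>\<omega>. norm (v - w) * norm (X k \<omega>) \<partial>P)"
    proof (rule order_trans[OF integral_norm_bound], rule integral_mono_AE)
      show "integrable P (\<lambda>\<omega>. norm (v - w) * norm (X k \<omega>))"
        by (intro integrable_mult_right integrable_norm X_int k)
      show "AE \<omega> in P. norm (f (A k \<omega>) (v \<bullet> X k \<omega>) - f (A k \<omega>) (w \<bullet> X k \<omega>)) \<le> norm (v - w) * norm (X k \<omega>)"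
        using A_bounds[OF k]
      proof eventually_elim
        case (elim \<omega>)
        then have "norm (f (A k \<omega>) (v \<bullet> X k \<omega>) - f (A k \<omega>) (w \<bullet> X k \<omega>)) \<le> \<bar>(v - w) \<bullet> X k \<omega>\<bar>"
          using f by (simp add: inner_diff_left)
        also have "\<dots> \<le> norm (v - w) * norm (X k \<omega>)" by (rule Cauchy_Schwarz_ineq2)
        finally show ?case .
      qed
    qed (intro integrable_norm Bochner_Integration.integrable_diff int)
    finally show ?thesis by (simp add: mult.commute)
  qed
  moreover have "0 \<le> ?L" by simp
  ultimately have "?L-lipschitz_on UNIV ?J"
    by (intro lipschitz_onI) (auto simp: dist_real_def dist_norm)
  then show ?thesis by (rule lipschitz_on_continuous_on)
qed

lemma continuous_on_risk: "continuous_on UNIV risk"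
  unfolding risk_def
  by (intro continuous_intros integral_inner_lipschitz soft_loss_lipschitz integrable_soft_loss)

text \<open>The constant \<open>b\<close> is the minimum of the expected hinge loss over the unit
  sphere; homogeneity extends the bound to all \<open>w\<close>.\<close>

lemma risk_coercive: obtains b where "0 < b" "\<And>w. b * norm w \<le> risk w"
proof -
  define h where "h w = c * (\<Sum>k\<in>K. \<integral>\<omega>. hinge (A k \<omega>) (w \<bullet> X k \<omega>) \<partial>P)" for w
  have cont: "continuous_on UNIV h"
    unfolding h_def by (intro continuous_intros integral_inner_lipschitz hinge_bounds integrable_hinge)
  have nonneg: "AE \<omega> in P. 0 \<le> hinge (A k \<omega>) (w \<bullet> X k \<omega>)" if "k \<in> K" for k w
    using A_bounds[OF that] by eventually_elim (use hinge_bounds in auto)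
  have h_pos: "0 < h w" if w0: "w \<noteq> 0" for w
  proof -
    obtain k where k: "k \<in> K" "\<not> (AE \<omega> in P. hinge (A k \<omega>) (w \<bullet> X k \<omega>) = 0)"
      using nondegenerate[OF w0] by blast
    have "0 \<le> (\<integral>\<omega>. hinge (A k \<omega>) (w \<bullet> X k \<omega>) \<partial>P)" if "k \<in> K" for k
      by (rule integral_nonneg_AE[OF nonneg[OF that]])
    \<comment> \<open>A nonnegative function with integral 0 vanishes almost everywhere, which the
      choice of \<open>k\<close> excludes.\<close>
    moreover have "(\<integral>\<omega>. hinge (A k \<omega>) (w \<bullet> X k \<omega>) \<partial>P) \<noteq> 0"
      using k integral_nonneg_eq_0_iff_AE[OF integrable_hinge[OF k(1)] nonneg[OF k(1)]] by blast
    ultimately have "0 < (\<Sum>k\<in>K. \<integral>\<omega>. hinge (A k \<omega>) (w \<bullet> X k \<omega>) \<partial>P)"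
      using finite_K k(1) by (intro sum_pos2[of _ k]) (auto simp: less_le)
    then show ?thesis using c_pos by (simp add: h_def)
  qed
  have h_le: "h w \<le> risk w" for w
    unfolding h_def risk_def
  proof (intro mult_left_mono sum_mono integral_mono_AE integrable_hinge integrable_soft_loss)
    show "AE \<omega> in P. hinge (A k \<omega>) (w \<bullet> X k \<omega>) \<le> soft_loss (A k \<omega>) (w \<bullet> X k \<omega>)" if "k \<in> K" for k
      using A_bounds[OF that] by eventually_elim (use hinge_bounds in auto)
  qed (use c_pos in auto)
  have h_scale: "h (t *\<^sub>R w) = t * h w" if "0 \<le> t" for t w
    unfolding h_def inner_scaleR_left hinge_scale[OF that] integral_mult_right_zero sum_distrib_left[symmetric]
    by simp
  have ne: "sphere (0::'b) 1 \<noteq> {}" by simp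
  obtain w0 where w0: "w0 \<in> sphere 0 1" "\<And>w. w \<in> sphere 0 1 \<Longrightarrow> h w0 \<le> h w"
    using continuous_attains_inf[OF compact_sphere ne continuous_on_subset[OF cont]] by blast
  show ?thesis
  proof
    show "0 < h w0" using w0(1) by (intro h_pos) auto
    fix w :: 'b
    have "h w0 * norm w \<le> h w"
    proof (cases "w = 0")
      case True
      then show ?thesis by (simp add: h_def hinge_def)
    next
      case False
      have "h w0 * norm w \<le> h (w /\<^sub>R norm w) * norm w"
        using False by (intro mult_right_mono w0(2)) auto
      also have "\<dots> = h (norm w *\<^sub>R (w /\<^sub>R norm w))" by (simp only: h_scale[OF norm_ge_zero] mult.commute)
      also have "norm w *\<^sub>R (w /\<^sub>R norm w) = w" using False by simp
      finally show ?thesis .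
    qed
    then show "h w0 * norm w \<le> risk w" using h_le[of w] by linarith
  qed
qed

text \<open>Every index satisfies the weak midpoint inequality. By nondegeneracy at
  \<open>v - w\<close>, some index gives different scores to \<open>v\<close> and \<open>w\<close>
  with positive probability, and there the inequality is strict.\<close>

lemma risk_midpoint_less:
  assumes "v \<noteq> w" shows "2 * risk ((1/2) *\<^sub>R (v + w)) < risk v + risk w"
proof -
  let ?J = "\<lambda>k w. \<integral>\<omega>. soft_loss (A k \<omega>) (w \<bullet> X k \<omega>) \<partial>P"
  have mid: "((1/2) *\<^sub>R (v + w)) \<bullet> x = (v \<bullet> x + w \<bullet> x) / 2" for x
    by (simp add: inner_add_left)
  have le: "AE \<omega> in P. 2 * soft_loss (A k \<omega>) (((1/2) *\<^sub>R (v + w)) \<bullet> X k \<omega>)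
      \<le> soft_loss (A k \<omega>) (v \<bullet> X k \<omega>) + soft_loss (A k \<omega>) (w \<bullet> X k \<omega>)" if "k \<in> K" for k
    unfolding mid using A_bounds[OF that] by eventually_elim (use soft_loss_midpoint in auto)
  note ints = integrable_mult_right[OF integrable_soft_loss] Bochner_Integration.integrable_add[OF integrable_soft_loss integrable_soft_loss]
  have eq: "2 * ?J k u = (\<integral>\<omega>. 2 * soft_loss (A k \<omega>) (u \<bullet> X k \<omega>) \<partial>P)"
    "?J k v + ?J k w = (\<integral>\<omega>. soft_loss (A k \<omega>) (v \<bullet> X k \<omega>) + soft_loss (A k \<omega>) (w \<bullet> X k \<omega>) \<partial>P)"
    if "k \<in> K" for k u
    using integrable_soft_loss[OF that] by simp_all
  obtain k where k: "k \<in> K" "\<not> (AE \<omega> in P. hinge (A k \<omega>) ((v - w) \<bullet> X k \<omega>) = 0)"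
    using nondegenerate[of "v - w"] assms by auto
  have "(\<Sum>k\<in>K. 2 * ?J k ((1/2) *\<^sub>R (v + w))) < (\<Sum>k\<in>K. ?J k v + ?J k w)"
  proof (rule sum_strict_mono_ex1[OF finite_K])
    show "\<forall>k\<in>K. 2 * ?J k ((1/2) *\<^sub>R (v + w)) \<le> ?J k v + ?J k w"
      by (auto simp only: eq intro!: integral_mono_AE ints le)
    show "\<exists>k\<in>K. 2 * ?J k ((1/2) *\<^sub>R (v + w)) < ?J k v + ?J k w"
    proof (intro bexI[of _ k])
      let ?N = "{\<omega> \<in> space P. v \<bullet> X k \<omega> \<noteq> w \<bullet> X k \<omega>}"
      have meas: "?N \<in> sets P" using k(1) by measurable
      show "2 * ?J k ((1/2) *\<^sub>R (v + w)) < ?J k v + ?J k w"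
        unfolding eq[OF k(1)]
      proof (rule integral_less_AE[where A = ?N, OF ints(1)[OF k(1)] ints(2)[OF k(1) k(1)] _ meas _ le[OF k(1)]])
        show "emeasure P ?N \<noteq> 0"
        proof
          assume "emeasure P ?N = 0"
          then have "AE \<omega> in P. v \<bullet> X k \<omega> = w \<bullet> X k \<omega>"
            using meas by (subst AE_iff_measurable[OF meas]) auto
          \<comment> \<open>Equal scores mean score 0 for \<open>v - w\<close>, where the hinge loss
            vanishes.\<close>
          then have "AE \<omega> in P. hinge (A k \<omega>) ((v - w) \<bullet> X k \<omega>) = 0"
            by eventually_elim (simp add: hinge_def inner_diff_left)
          with k(2) show False ..
        qed
        show "AE \<omega> in P. \<omega> \<in> ?N \<longrightarrow> 2 * soft_loss (A k \<omega>) (((1/2) *\<^sub>R (v + w)) \<bullet> X k \<omega>)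
           \<noteq> soft_loss (A k \<omega>) (v \<bullet> X k \<omega>) + soft_loss (A k \<omega>) (w \<bullet> X k \<omega>)"
          unfolding mid using A_bounds[OF k(1)] 
        proof eventually_elim
          case (elim \<omega>)
          then show ?case using soft_loss_midpoint(2)[of "A k \<omega>" "v \<bullet> X k \<omega>" "w \<bullet> X k \<omega>"] by auto
        qed
      qed
    qed fact
  qed
  then have "c * (\<Sum>k\<in>K. 2 * ?J k ((1/2) *\<^sub>R (v + w))) < c * (\<Sum>k\<in>K. ?J k v + ?J k w)"
    using c_pos by simp
  then show ?thesis by (simp add: risk_def sum_distrib_left[symmetric] sum.distrib algebra_simps)
qed

lemma ex1_risk_minimizer: "\<exists>!w. is_arg_min risk (\<lambda>w. True) w"
proof -
  obtain b where b: "0 < b" "\<And>w. b * norm w \<le> risk w" using risk_coercive by blast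
  \<comment> \<open>Outside the ball of this radius coercivity makes the risk larger than
    \<open>risk 0\<close>, so a minimizer over the ball is global.\<close>
  let ?R = "risk 0 / b"
  have "0 \<le> risk 0" using b(2)[of 0] by simp
  then have R: "0 \<le> ?R" using b(1) by (rule divide_nonneg_pos)
  then have ne: "cball (0::'b) ?R \<noteq> {}" by (simp add: not_less)
  obtain w0 where w0: "w0 \<in> cball 0 ?R" "\<And>w. w \<in> cball 0 ?R \<Longrightarrow> risk w0 \<le> risk w"
    using continuous_attains_inf[OF compact_cball ne continuous_on_subset[OF continuous_on_risk]] by blast
  have min: "risk w0 \<le> risk w" for w
  proof (cases "w \<in> cball 0 ?R")
    case False
    then have "risk 0 < b * norm w" using b(1) by (simp add: field_simps)
    also have "\<dots> \<le> risk w" by (rule b(2))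
    finally show ?thesis using w0(2)[of 0] R by (simp add: not_less)
  qed (rule w0(2))
  show ?thesis
  proof (rule ex1I)
    show "is_arg_min risk (\<lambda>w. True) w0" using min by (auto simp: is_arg_min_linorder)
    fix v assume v: "is_arg_min risk (\<lambda>w. True) v"
    show "v = w0"
    proof (rule ccontr)
      assume "v \<noteq> w0"
      then have "2 * risk ((1/2) *\<^sub>R (v + w0)) < risk v + risk w0" by (rule risk_midpoint_less)
      moreover have "risk v \<le> risk w0" using v by (simp add: is_arg_min_linorder)
      ultimately show False using min[of "(1/2) *\<^sub>R (v + w0)"] by linarith
    qed
  qed
qed

end

section \<open>Stability of minimizers under perturbation\<close>

text \<open>For small \<open>s\<close> the minimizers stay in a fixed ball. On the part of it away
  from \<open>m 0\<close>, compactness and uniqueness keep \<open>F 0\<close> above its minimum by a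
  gap \<open>d\<close>, while the perturbation bound puts \<open>F 0 (m s)\<close> within less than
  \<open>d\<close> of that minimum.\<close>

lemma minimizer_tendsto:
  fixes F :: "real \<Rightarrow> 'b::euclidean_space \<Rightarrow> real"
  assumes cont: "continuous_on UNIV (F 0)"
    and b: "0 < b" "\<And>w. b * norm w \<le> F 0 w"
    and C: "0 \<le> C" "\<And>s w. 0 \<le> s \<Longrightarrow> \<bar>F s w - F 0 w\<bar> \<le> C * s * norm w"
    and m: "\<And>s. 0 \<le> s \<Longrightarrow> is_arg_min (F s) (\<lambda>w. True) (m s)"
    and uniq: "\<And>v. is_arg_min (F 0) (\<lambda>w. True) v \<Longrightarrow> v = m 0"
  shows "(m \<longlongrightarrow> m 0) (at_right 0)"
proof (rule tendstoI)
  fix e :: real assume e: "0 < e"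
  have min: "F s (m s) \<le> F s w" if "0 \<le> s" for s w
    using m[OF that] by (auto simp: is_arg_min_linorder)
  \<comment> \<open>From \<open>b * norm (m s) \<le> F 0 0 + C * s * norm (m s)\<close>; once
    \<open>C * s < b / 2\<close> the last term is absorbed into the left side, which costs the
    factor 2.\<close>
  define R where "R = 2 * F 0 0 / b"
  let ?A = "cball 0 R - ball (m 0) e"
  have "\<exists>d>0. \<forall>w\<in>?A. F 0 (m 0) + d \<le> F 0 w"
  proof (cases "?A = {}")
    case False
    have "compact ?A" by (intro compact_diff) auto
    then obtain w0 where w0: "w0 \<in> ?A" "\<And>w. w \<in> ?A \<Longrightarrow> F 0 w0 \<le> F 0 w"
      using continuous_attains_inf[OF _ False continuous_on_subset[OF cont]] by blast
    have "F 0 (m 0) < F 0 w0"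
    proof (rule ccontr)
      assume "\<not> ?thesis"
      then have "is_arg_min (F 0) (\<lambda>w. True) w0" using order_trans[OF _ min[of 0]] by (simp add: is_arg_min_linorder not_less)
      then have "w0 = m 0" by (rule uniq)
      with w0(1) e show False by simp
    qed
    then show ?thesis using w0(2) by (intro exI[of _ "F 0 w0 - F 0 (m 0)"]) auto
  qed (auto intro: exI[of _ 1])
  then obtain d where d: "0 < d" "\<And>w. w \<in> ?A \<Longrightarrow> F 0 (m 0) + d \<le> F 0 w" by blast
  have 1: "((\<lambda>s. C * s) \<longlongrightarrow> C * 0) (at_right 0)" and 2: "((\<lambda>s. C * s * (R + norm (m 0))) \<longlongrightarrow> C * 0 * (R + norm (m 0))) (at_right 0)"
    by (intro tendsto_intros)+
  have "\<forall>\<^sub>F s in at_right 0. C * s < b / 2" "\<forall>\<^sub>F s in at_right 0. C * s * (R + norm (m 0)) < d"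
    using order_tendstoD(2)[OF 1, of "b / 2"] order_tendstoD(2)[OF 2, of d] b d by auto
  moreover have "\<forall>\<^sub>F s in at_right (0::real). 0 < s" by (simp add: eventually_at_right_less)
  ultimately show "\<forall>\<^sub>F s in at_right 0. dist (m s) (m 0) < e"
  proof eventually_elim
    case (elim s)
    then have s: "0 \<le> s" by simp
    have "b * norm (m s) \<le> F s (m s) + C * s * norm (m s)"
      using b(2)[of "m s"] C(2)[OF s, of "m s"] by linarith
    also have "C * s * norm (m s) \<le> b / 2 * norm (m s)" using elim by (intro mult_right_mono) auto
    also have "F s (m s) \<le> F s 0" by (rule min[OF s])
    \<comment> \<open>The perturbation bound is proportional to \<open>norm w\<close>, so it
      vanishes at \<open>w = 0\<close>.\<close>
    also have "F s 0 \<le> F 0 0" using C(2)[OF s, of 0] by simp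
    finally have "b * norm (m s) \<le> 2 * F 0 0" by simp
    then have R: "norm (m s) \<le> R" using b(1) by (simp add: R_def field_simps)
    have "F 0 (m s) \<le> F s (m s) + C * s * norm (m s)" using C(2)[OF s, of "m s"] by linarith
    also have "F s (m s) \<le> F s (m 0)" by (rule min[OF s])
    also have "F s (m 0) \<le> F 0 (m 0) + C * s * norm (m 0)" using C(2)[OF s, of "m 0"] by linarith
    also have "C * s * norm (m s) \<le> C * s * R" using C s R by (intro mult_left_mono) auto
    finally have "F 0 (m s) < F 0 (m 0) + d" using elim by (simp add: distrib_left)
    then have "m s \<notin> ?A" using d(2)[of "m s"] by linarith
    then show ?case using R by (simp add: dist_commute)
  qed
qed

section \<open>Coupling the samples\<close>

lemma (in prob_space) distr_pair_snd:
  assumes "prob_space N" shows "distr (M \<Otimes>\<^sub>M N) N snd = N"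
proof (intro measure_eqI)
  interpret N: prob_space N by fact
  fix B assume B: "B \<in> sets (distr (M \<Otimes>\<^sub>M N) N snd)"
  then have "emeasure (distr (M \<Otimes>\<^sub>M N) N snd) B = emeasure (M \<Otimes>\<^sub>M N) (space M \<times> B)"
    by (auto simp add: emeasure_distr space_pair_measure dest: sets.sets_into_space intro!: arg_cong2[where f=emeasure])
  with B show "emeasure (distr (M \<Otimes>\<^sub>M N) N snd) B = emeasure N B"
    by (simp add: N.emeasure_pair_measure_Times emeasure_space_1)
qed simp

lemma borel_measurable_fst_borel [measurable]:
  "fst \<in> borel_measurable (borel :: ('a::second_countable_topology \<times> 'b::second_countable_topology) measure)"
  by (intro borel_measurable_continuous_onI continuous_intros)

lemma borel_measurable_snd_borel [measurable]:
  "snd \<in> borel_measurable (borel :: ('a::second_countable_topology \<times> 'b::second_countable_topology) measure)"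
  by (intro borel_measurable_continuous_onI continuous_intros)

text \<open>Each point outside the support lies in a null basic open set, and a countable basis has
  only countably many of these.\<close>

lemma AE_in_msupport:
  fixes P :: "'a::second_countable_topology measure"
  assumes P: "sets P = sets borel"
  shows "AE x in P. x \<in> msupport P"
proof -
  obtain B :: "'a set set" where B: "countable B" "topological_basis B"
    using ex_countable_basis by blast
  let ?N = "\<Union>V\<in>{V\<in>B. emeasure P V = 0}. V"
  have "?N \<in> null_sets P"
  proof (rule null_sets_UN')
    show "countable {V \<in> B. emeasure P V = 0}" using B(1) by simp
    show "V \<in> null_sets P" if "V \<in> {V \<in> B. emeasure P V = 0}" for V
      using that topological_basis_open[OF B(2)] P by (auto simp: null_sets_def)
  qed
  moreover have "{x \<in> space P. x \<notin> msupport P} \<subseteq> ?N"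
  proof
    fix x assume "x \<in> {x \<in> space P. x \<notin> msupport P}"
    then obtain U where U: "open U" "x \<in> U" "emeasure P U = 0"
      by (auto simp: msupport_def)
    then obtain V where V: "V \<in> B" "x \<in> V" "V \<subseteq> U" using topological_basisE[OF B(2)] by metis
    then have "emeasure P V \<le> emeasure P U" using U P by (intro emeasure_mono) auto
    then show "x \<in> ?N" using U V by auto
  qed
  ultimately show ?thesis by (rule AE_I')
qed

text \<open>Converts the support condition into the almost sure form used in all later
  estimates.\<close>

lemma mask_distribution_AE:
  assumes "mask_distribution \<M>"
  shows "AE p in \<M>. (\<forall>i. fst p $ i \<in> {0, 1}) \<and> 0 \<le> snd p \<and> snd p \<le> 1"
proof -
  have "AE p in \<M>. p \<in> msupport \<M>"
    using assms by (intro AE_in_msupport) (simp add: mask_distribution_def)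
  moreover have "msupport \<M> \<subseteq> {M. \<forall>i. M $ i \<in> {0, 1}} \<times> {0..1}"
    using assms by (simp add: mask_distribution_def)
  ultimately have "AE p in \<M>. p \<in> {M. \<forall>i. M $ i \<in> {0, 1}} \<times> {0..1}"
    by (auto elim!: eventually_mono)
  then show ?thesis by eventually_elim auto
qed

section \<open>Algebra and measurability of masking\<close>

lemma borel_measurable_vec_times:
  fixes f g :: "'a \<Rightarrow> real^'d"
  assumes [measurable]: "f \<in> borel_measurable M" "g \<in> borel_measurable M"
  shows "(\<lambda>x. f x * g x) \<in> borel_measurable M"
proof (subst borel_measurable_euclidean_space, intro ballI)
  fix b :: "real^'d" assume "b \<in> Basis"
  then obtain i where b: "b = axis i 1" by (auto simp: Basis_vec_def)
  have "(\<lambda>x. (f x * g x) \<bullet> b) = (\<lambda>x. (f x \<bullet> b) * (g x \<bullet> b))"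
    by (simp add: b inner_axis times_vec_def)
  then show "(\<lambda>x. (f x * g x) \<bullet> b) \<in> borel_measurable M" by simp
qed

lemma borel_measurable_mask_mix_x [measurable (raw)]:
  assumes [measurable]: "f \<in> borel_measurable M" "g \<in> borel_measurable M" "h \<in> borel_measurable M"
  shows "(\<lambda>x. mask_mix_x (f x) (g x) (h x)) \<in> borel_measurable M"
  unfolding mask_mix_x_def by (intro borel_measurable_add borel_measurable_vec_times) measurable

lemma borel_measurable_mask_mix_y [measurable (raw)]:
  assumes [measurable]: "f \<in> borel_measurable M" "g \<in> borel_measurable M" "h \<in> borel_measurable M"
  shows "(\<lambda>x. mask_mix_y (f x) (g x) (h x)) \<in> borel_measurable M"
  unfolding mask_mix_y_def by measurable

lemma mask_mix_x_same: "mask_mix_x M x x = x"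
  by (simp add: mask_mix_x_def algebra_simps)

text \<open>Mixing noiseless points of opposite classes gives exactly the vectors of the span
  condition.\<close>

lemma mask_mix_x_uminus: "mask_mix_x M x (- x) = x * (2 *\<^sub>R M - 1)"
  by (simp add: mask_mix_x_def vec_eq_iff algebra_simps)

lemma mask_mix_x_diff: "mask_mix_x M x y - mask_mix_x M x' y' = mask_mix_x M (x - x') (y - y')"
  by (simp add: mask_mix_x_def algebra_simps)

lemma norm_mask_mix_x_le:
  assumes "\<forall>i. M $ i \<in> {0, 1}"
  shows "norm (mask_mix_x M x y) \<le> norm x + norm y"
proof -
  have "norm (M * x) \<le> norm x" "norm ((1 - M) * y) \<le> norm y"
  proof -
    have "\<bar>M $ i * x $ i\<bar> \<le> \<bar>x $ i\<bar>" "\<bar>(1 - M $ i) * y $ i\<bar> \<le> \<bar>y $ i\<bar>" for i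
      using assms[rule_format, of i] by auto
    then show "norm (M * x) \<le> norm x" "norm ((1 - M) * y) \<le> norm y"
      by (auto intro!: norm_le_componentwise_cart)
  qed
  then show ?thesis unfolding mask_mix_x_def by (intro norm_triangle_le add_mono)
qed

lemma mask_mix_y_bounds:
  assumes "0 \<le> l" "l \<le> 1" "0 \<le> y" "y \<le> 1" "0 \<le> y'" "y' \<le> 1"
  shows "0 \<le> mask_mix_y l y y'" "mask_mix_y l y y' \<le> 1"
  using assms convex_bound_le[of y 1 y' l "1 - l"] by (auto simp: mask_mix_y_def)

section \<open>Data as an image of pure noise\<close>

definition noise_kernel :: "real^'d^'d \<Rightarrow> real \<Rightarrow> ((real^'d) \<times> real) measure" where
  "noise_kernel \<Sigma> y = distr (gaussian 0 \<Sigma>) borel (\<lambda>x. (x, y))"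

text \<open>The law of noise and label before \<mu> and \<kappa> enter. It has the same bind
  structure as \<open>data_law\<close>, so the two are related by pushing the image map through the
  bind.\<close>

definition noise_law :: "real^'d^'d \<Rightarrow> ((real^'d) \<times> real) measure" where
  "noise_law \<Sigma> = measure_pmf (pmf_of_set {0, 1}) \<bind> noise_kernel \<Sigma>"

definition data_of_noise :: "real^'d \<Rightarrow> real \<Rightarrow> (real^'d) \<times> real \<Rightarrow> (real^'d) \<times> real" where
  "data_of_noise \<mu> s p = ((2 * snd p - 1) *\<^sub>R \<mu> + s *\<^sub>R fst p, snd p)"

lemma borel_measurable_data_of_noise [measurable]: "data_of_noise \<mu> s \<in> borel_measurable borel"
  unfolding data_of_noise_def[abs_def] by (intro borel_measurable_Pair) measurable

lemma measurable_noise_embedding [measurable]: "(\<lambda>x::real^'d. (x, y::real)) \<in> gaussian 0 \<Sigma> \<rightarrow>\<^sub>M borel"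
  by (intro borel_measurable_Pair) auto

lemma noise_kernel_measurable:
  assumes "pos_def_matrix \<Sigma>"
  shows "noise_kernel \<Sigma> \<in> measure_pmf p \<rightarrow>\<^sub>M subprob_algebra borel"
  using prob_space_gaussian_0[OF assms]
  by (auto simp: noise_kernel_def space_subprob_algebra
      intro!: prob_space_imp_subprob_space prob_space.prob_space_distr)

lemma prob_space_noise_law:
  assumes "pos_def_matrix \<Sigma>" shows "prob_space (noise_law \<Sigma>)"
  unfolding noise_law_def
  by (rule measure_pmf.prob_space_bind[OF _ noise_kernel_measurable[OF assms]])
    (auto simp: noise_kernel_def intro!: AE_I2 prob_space.prob_space_distr prob_space_gaussian_0[OF assms])

lemma sets_noise_law [measurable_cong]:
  assumes "pos_def_matrix \<Sigma>" shows "sets (noise_law \<Sigma>) = sets borel"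
  unfolding noise_law_def by (rule sets_bind[where N = borel]) (auto simp: noise_kernel_def)

text \<open>Both labels have positive mass, so an almost sure statement holds precisely when it
  holds for each label separately.\<close>

lemma AE_noise_law_iff:
  assumes S: "pos_def_matrix \<Sigma>" and P [measurable]: "Measurable.pred borel P"
  shows "(AE p in noise_law \<Sigma>. P p) \<longleftrightarrow> (\<forall>y\<in>{0, 1}. AE g in gaussian 0 \<Sigma>. P (g, y))"
proof -
  have "(AE p in noise_law \<Sigma>. P p) \<longleftrightarrow> (AE y in measure_pmf (pmf_of_set {0, 1}). AE p in noise_kernel \<Sigma> y. P p)"
    unfolding noise_law_def by (rule AE_bind[OF noise_kernel_measurable[OF S] P])
  also have "\<dots> \<longleftrightarrow> (\<forall>y\<in>{0, 1}. AE p in noise_kernel \<Sigma> y. P p)"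
    by (simp add: AE_measure_pmf_iff)
  also have "\<dots> \<longleftrightarrow> (\<forall>y\<in>{0, 1}. AE g in gaussian 0 \<Sigma>. P (g, y))"
  proof -
    have "(AE p in noise_kernel \<Sigma> y. P p) \<longleftrightarrow> (AE g in gaussian 0 \<Sigma>. P (g, y))" for y
      unfolding noise_kernel_def by (rule AE_distr_iff) (auto intro: P[unfolded pred_def])
    then show ?thesis by simp
  qed
  finally show ?thesis .
qed

lemma integrable_noise_law:
  assumes S: "pos_def_matrix \<Sigma>"
  shows "integrable (noise_law \<Sigma>) (\<lambda>p. norm (fst p))"
proof (rule integrableI_nonneg)
  have "(\<integral>\<^sup>+p. ennreal (norm (fst p)) \<partial>noise_law \<Sigma>)
      = (\<integral>\<^sup>+y. \<integral>\<^sup>+p. ennreal (norm (fst p)) \<partial>noise_kernel \<Sigma> y \<partial>measure_pmf (pmf_of_set {0, 1}))"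
    unfolding noise_law_def by (rule nn_integral_bind[OF _ noise_kernel_measurable[OF S]]) simp
  also have "\<dots> = (\<integral>\<^sup>+g. ennreal (norm g) \<partial>gaussian 0 \<Sigma>)"
    by (simp add: noise_kernel_def nn_integral_distr measure_pmf.emeasure_space_1)
  also have "\<dots> < \<infinity>"
    using integrable_norm_gaussian_0[OF S] by (simp add: integrable_iff_bounded)
  finally show "(\<integral>\<^sup>+p. ennreal (norm (fst p)) \<partial>noise_law \<Sigma>) < \<infinity>" .
qed (auto simp: measurable_cong_sets[OF sets_noise_law[OF S] refl])

definition noise_scale :: "ereal \<Rightarrow> real" where
  "noise_scale \<kappa> = (if \<kappa> = \<infinity> then 0 else 1 / sqrt (real_of_ereal \<kappa>))"

lemma noise_scale_nonneg: "0 < \<kappa> \<Longrightarrow> 0 \<le> noise_scale \<kappa>"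
  by (cases \<kappa>) (auto simp: noise_scale_def)

text \<open>For infinite \<kappa> the map is constant and its image is the point mass; otherwise
  this is \<open>gaussian_scale\<close>.\<close>

lemma class_law_eq_distr:
  assumes S: "pos_def_matrix \<Sigma>" and k: "0 < \<kappa>"
  shows "class_law \<Sigma> \<kappa> m = distr (gaussian 0 \<Sigma>) borel (\<lambda>x. m + noise_scale \<kappa> *\<^sub>R x)"
proof (cases "\<kappa> = \<infinity>")
  case True
  then show ?thesis
    using prob_space.distr_const[OF prob_space_gaussian_0[OF S], of m borel]
    by (simp add: class_law_def noise_scale_def)
next
  case False
  then have "0 < real_of_ereal \<kappa>" using k by (cases \<kappa>) auto
  then show ?thesis using False gaussian_scale[OF S, of "real_of_ereal \<kappa>" m]
    by (simp add: class_law_def noise_scale_def)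
qed

lemma data_law_eq_distr:
  assumes S: "pos_def_matrix \<Sigma>" and k: "0 < \<kappa>"
  shows "data_law \<mu> \<Sigma> \<kappa> = distr (noise_law \<Sigma>) borel (data_of_noise \<mu> (noise_scale \<kappa>))"
proof -
  have "distr (noise_law \<Sigma>) borel (data_of_noise \<mu> (noise_scale \<kappa>))
      = measure_pmf (pmf_of_set {0, 1}) \<bind> (\<lambda>y. distr (noise_kernel \<Sigma> y) borel (data_of_noise \<mu> (noise_scale \<kappa>)))"
    unfolding noise_law_def by (rule distr_bind[OF noise_kernel_measurable[OF S]]) auto
  also have "\<dots> = data_law \<mu> \<Sigma> \<kappa>"
  proof -
    have [measurable]: "(\<lambda>x::real^'d. (x, y::real)) \<in> borel \<rightarrow>\<^sub>M borel" for y
      by (intro borel_measurable_Pair) auto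
    show ?thesis
      unfolding data_law_def class_law_eq_distr[OF S k] noise_kernel_def
      by (subst (1 2) distr_distr) (auto simp: o_def data_of_noise_def)
  qed
  finally show ?thesis by simp
qed

section \<open>The masked Mixup risk\<close>

locale mask_model =
  fixes \<mu> :: "real^'d" and \<Sigma> :: "real^'d^'d" and \<M> :: "((real^'d) \<times> real) measure" and n :: nat
  assumes \<Sigma>: "pos_def_matrix \<Sigma>" and \<M>: "mask_distribution \<M>" "mask_assumption \<mu> \<M>" and n: "2 \<le> n"
begin

abbreviation "Q \<equiv> noise_law \<Sigma>"
abbreviation "I \<equiv> {1..n}"
abbreviation "K \<equiv> {1..n} \<times> {1..n}"

text \<open>The common probability space: it does not involve \<kappa>, which enters only through
  the argument \<open>s\<close> of \<open>feature\<close>.\<close>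

definition base_law where
  "base_law = (\<Pi>\<^sub>M i\<in>I. Q) \<Otimes>\<^sub>M (\<Pi>\<^sub>M k\<in>K. \<M>)"

definition label :: "nat \<times> nat \<Rightarrow> (nat \<Rightarrow> (real^'d) \<times> real) \<times> (nat \<times> nat \<Rightarrow> (real^'d) \<times> real) \<Rightarrow> real" where
  "label k \<omega> = mask_mix_y (snd (snd \<omega> k)) (snd (fst \<omega> (fst k))) (snd (fst \<omega> (snd k)))"

definition feature :: "real \<Rightarrow> nat \<times> nat \<Rightarrow> (nat \<Rightarrow> (real^'d) \<times> real) \<times> (nat \<times> nat \<Rightarrow> (real^'d) \<times> real) \<Rightarrow> real^'d" where
  "feature s k \<omega> = mask_mix_x (fst (snd \<omega> k))
     (fst (data_of_noise \<mu> s (fst \<omega> (fst k)))) (fst (data_of_noise \<mu> s (fst \<omega> (snd k))))"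

lemma prob_Q: "prob_space Q" by (rule prob_space_noise_law[OF \<Sigma>])
lemma sets_Q [measurable_cong]: "sets Q = sets borel" by (rule sets_noise_law[OF \<Sigma>])
lemma prob_\<M>: "prob_space \<M>" using \<M>(1) by (simp add: mask_distribution_def)
lemma sets_\<M> [measurable_cong]: "sets \<M> = sets borel" using \<M>(1) by (simp add: mask_distribution_def)

lemma prob_base_law: "prob_space base_law"
  unfolding base_law_def by (intro prob_space_pair prob_space_PiM prob_Q prob_\<M>)

lemma distr_base_law_sample:
  assumes i: "i \<in> I" shows "distr base_law Q (\<lambda>\<omega>. fst \<omega> i) = Q"
proof -
  have "distr (distr base_law (\<Pi>\<^sub>M i\<in>I. Q) fst) Q (\<lambda>S. S i) = distr base_law Q (\<lambda>\<omega>. fst \<omega> i)"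
    using i by (subst distr_distr) (auto simp: base_law_def o_def)
  also have "distr base_law (\<Pi>\<^sub>M i\<in>I. Q) fst = (\<Pi>\<^sub>M i\<in>I. Q)"
    unfolding base_law_def by (intro prob_space.distr_pair_fst prob_space_PiM prob_\<M>)
  finally show ?thesis using distr_PiM_component[of I "\<lambda>_. Q", OF prob_Q i] by simp
qed

lemma distr_base_law_mask:
  assumes k: "k \<in> K" shows "distr base_law \<M> (\<lambda>\<omega>. snd \<omega> k) = \<M>"
proof -
  have "distr (distr base_law (\<Pi>\<^sub>M k\<in>K. \<M>) snd) \<M> (\<lambda>T. T k) = distr base_law \<M> (\<lambda>\<omega>. snd \<omega> k)"
    using k by (subst distr_distr) (auto simp: base_law_def o_def)
  also have "distr base_law (\<Pi>\<^sub>M k\<in>K. \<M>) snd = (\<Pi>\<^sub>M k\<in>K. \<M>)"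
    unfolding base_law_def by (intro prob_space.distr_pair_snd prob_space_PiM prob_\<M> prob_Q)
  finally show ?thesis using distr_PiM_component[of K "\<lambda>_. \<M>", OF prob_\<M> k] by simp
qed

lemma measurable_sample [measurable]: "i \<in> I \<Longrightarrow> (\<lambda>\<omega>. fst \<omega> i) \<in> base_law \<rightarrow>\<^sub>M Q"
  unfolding base_law_def by measurable

lemma measurable_mask [measurable]: "k \<in> K \<Longrightarrow> (\<lambda>\<omega>. snd \<omega> k) \<in> base_law \<rightarrow>\<^sub>M \<M>"
  unfolding base_law_def by measurable

lemma measurable_sample_borel [measurable]: "i \<in> I \<Longrightarrow> (\<lambda>\<omega>. fst \<omega> i) \<in> borel_measurable base_law"
  using measurable_sample by (simp cong: measurable_cong_sets add: measurable_cong_sets[OF refl sets_Q])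

lemma measurable_mask_borel [measurable]: "k \<in> K \<Longrightarrow> (\<lambda>\<omega>. snd \<omega> k) \<in> borel_measurable base_law"
  using measurable_mask by (simp cong: measurable_cong_sets add: measurable_cong_sets[OF refl sets_\<M>])

lemma AE_sample:
  assumes "i \<in> I" "AE p in Q. P p" shows "AE \<omega> in base_law. P (fst \<omega> i)"
  by (rule AE_distrD[OF measurable_sample[OF assms(1)]]) (subst distr_base_law_sample[OF assms(1)], rule assms(2))

lemma AE_label_noise: "AE p in Q. snd p \<in> {0, 1}"
proof -
  have [measurable]: "Measurable.pred borel (\<lambda>p :: (real^'d) \<times> real. snd p \<in> {0, 1})"
  proof -
    have "closed {p :: (real^'d) \<times> real. snd p = 0 \<or> snd p = 1}"
      by (intro closed_Collect_disj closed_Collect_eq continuous_intros)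
    then show ?thesis by (simp add: pred_def borel_closed)
  qed
  show ?thesis by (subst AE_noise_law_iff[OF \<Sigma>]) auto
qed

lemma AE_mask:
  assumes "k \<in> K" "AE p in \<M>. P p" shows "AE \<omega> in base_law. P (snd \<omega> k)"
  by (rule AE_distrD[OF measurable_mask[OF assms(1)]]) (subst distr_base_law_mask[OF assms(1)], rule assms(2))

lemma integrable_noise:
  assumes "i \<in> I" shows "integrable base_law (\<lambda>\<omega>. norm (fst (fst \<omega> i)))"
proof -
  have "integrable (distr base_law Q (\<lambda>\<omega>. fst \<omega> i)) (\<lambda>p. norm (fst p))"
    by (simp add: distr_base_law_sample[OF assms] integrable_noise_law[OF \<Sigma>])
  then show ?thesis using assms by (subst (asm) integrable_distr_eq) auto
qed

lemma label_measurable [measurable]: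
  assumes "k \<in> K" shows "label k \<in> borel_measurable base_law"
proof -
  have [measurable]: "fst k \<in> I" "snd k \<in> I" using assms by auto
  show ?thesis unfolding label_def[abs_def] using assms by measurable
qed

lemma feature_measurable [measurable]:
  assumes "k \<in> K" shows "feature s k \<in> borel_measurable base_law"
proof -
  have [measurable]: "fst k \<in> I" "snd k \<in> I" using assms by auto
  show ?thesis unfolding feature_def[abs_def] using assms by measurable
qed

lemma AE_label_bounds:
  assumes "k \<in> K" shows "AE \<omega> in base_law. 0 \<le> label k \<omega> \<and> label k \<omega> \<le> 1"
proof -
  have "fst k \<in> I" "snd k \<in> I" using assms by auto
  from AE_sample[OF this(1) AE_label_noise] AE_sample[OF this(2) AE_label_noise]
    AE_mask[OF assms mask_distribution_AE[OF \<M>(1)]]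
  show ?thesis
  proof eventually_elim
    case (elim \<omega>)
    then show ?case unfolding label_def by (intro conjI mask_mix_y_bounds) auto
  qed
qed

text \<open>Both noise levels share the labels, so the class means cancel and a masked mixture of
  the noise, scaled by \<open>s\<close>, remains.\<close>

lemma AE_feature_diff_le:
  assumes "k \<in> K" "0 \<le> s"
  shows "AE \<omega> in base_law. norm (feature s k \<omega> - feature 0 k \<omega>)
    \<le> s * (norm (fst (fst \<omega> (fst k))) + norm (fst (fst \<omega> (snd k))))"
  using AE_mask[OF assms(1) mask_distribution_AE[OF \<M>(1)]]
proof eventually_elim
  case (elim \<omega>)
  then have "norm (feature s k \<omega> - feature 0 k \<omega>)
      \<le> norm (s *\<^sub>R fst (fst \<omega> (fst k))) + norm (s *\<^sub>R fst (fst \<omega> (snd k)))"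
    unfolding feature_def mask_mix_x_diff data_of_noise_def fst_conv
    by (intro order_trans[OF norm_mask_mix_x_le]) auto
  then show ?case using assms(2) by (simp add: distrib_left)
qed

lemma integrable_feature:
  assumes k: "k \<in> K" and s: "0 \<le> s" shows "integrable base_law (feature s k)"
proof (rule Bochner_Integration.integrable_bound)
  have k12: "fst k \<in> I" "snd k \<in> I" using k by auto
  let ?b = "\<lambda>\<omega>. 2 * norm \<mu> + s * (norm (fst (fst \<omega> (fst k))) + norm (fst (fst \<omega> (snd k))))"
  show "integrable base_law ?b"
    using k12 prob_base_law
    by (intro Bochner_Integration.integrable_add integrable_mult_right integrable_noise finite_measure.integrable_const)
      (rule prob_space.finite_measure)
  show "AE \<omega> in base_law. norm (feature s k \<omega>) \<le> norm (?b \<omega>)"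
    using AE_feature_diff_le[OF k s] AE_mask[OF k mask_distribution_AE[OF \<M>(1)]]
      AE_sample[OF k12(1) AE_label_noise] AE_sample[OF k12(2) AE_label_noise]
  proof eventually_elim
    case (elim \<omega>)
    have "norm (feature 0 k \<omega>) \<le> norm ((2 * snd (fst \<omega> (fst k)) - 1) *\<^sub>R \<mu>) + norm ((2 * snd (fst \<omega> (snd k)) - 1) *\<^sub>R \<mu>)"
      using elim(2) unfolding feature_def data_of_noise_def
      by (intro order_trans[OF norm_mask_mix_x_le]) auto
    also have "\<dots> = 2 * norm \<mu>" using elim(3,4) by auto
    finally show ?case
      using elim(1) norm_triangle_sub[of "feature s k \<omega>" "feature 0 k \<omega>"] unfolding real_norm_def by linarith
  qed
qed (use k in measurable)

section \<open>Non-degeneracy with and without noise\<close>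

text \<open>In the diagonal term a point is mixed with itself and keeps its own label. Given label
  1, the noise puts it on the wrong side of the hyperplane of \<open>w\<close> with positive
  probability, because the wrong side is open and nonempty.\<close>

lemma nondegenerate_noise:
  assumes s: "0 < s" and w: "w \<noteq> 0"
  shows "\<not> (AE \<omega> in base_law. hinge (label (1, 1) \<omega>) (w \<bullet> feature s (1, 1) \<omega>) = 0)"
proof
  have i: "1 \<in> I" using n by simp
  let ?h = "\<lambda>p. hinge (snd p) (w \<bullet> fst (data_of_noise \<mu> s p))"
  have h: "hinge (label (1, 1) \<omega>) (w \<bullet> feature s (1, 1) \<omega>) = ?h (fst \<omega> 1)" for \<omega>
    by (simp add: label_def feature_def mask_mix_x_same mask_mix_y_def algebra_simps)
  have meas [measurable]: "?h \<in> borel_measurable borel" by measurable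
  assume "AE \<omega> in base_law. hinge (label (1, 1) \<omega>) (w \<bullet> feature s (1, 1) \<omega>) = 0"
  then have "AE p in distr base_law Q (\<lambda>\<omega>. fst \<omega> 1). ?h p = 0"
    unfolding h using i by (subst AE_distr_iff) auto
  then have "AE p in Q. ?h p = 0" by (simp only: distr_base_law_sample[OF i])
  then have "\<forall>y\<in>{0, 1}. AE g in gaussian 0 \<Sigma>. ?h (g, y) = 0"
    by (subst (asm) AE_noise_law_iff[OF \<Sigma>]) auto
  then have "AE g in gaussian 0 \<Sigma>. ?h (g, 1) = 0" by blast
  then have ae: "AE g in gaussian 0 \<Sigma>. g \<notin> {g. w \<bullet> (\<mu> + s *\<^sub>R g) < 0}"
  proof eventually_elim
    case (elim g)
    then show ?case using hinge_pos(1)[of 1 "w \<bullet> (\<mu> + s *\<^sub>R g)"] by (auto simp: data_of_noise_def)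
  qed
  let ?U = "{g. w \<bullet> (\<mu> + s *\<^sub>R g) < 0}"
  have U: "open ?U" by (intro open_Collect_less continuous_intros)
  \<comment> \<open>Going far enough along \<open>- w\<close>: the noise contributes
    \<open>- (\<bar>w \<bullet> \<mu>\<bar> + 1)\<close> to the score.\<close>
  have "- ((\<bar>w \<bullet> \<mu>\<bar> + 1) / (s * (w \<bullet> w))) *\<^sub>R w \<in> ?U"
    using s w by (simp add: inner_add_right)
  then have "0 < emeasure (gaussian 0 \<Sigma>) ?U"
    using emeasure_gaussian_open_pos[OF \<Sigma> U] by blast
  moreover have "?U \<in> null_sets (gaussian 0 \<Sigma>)"
    using ae U by (subst AE_iff_null_sets) auto
  ultimately show False by (auto simp: null_sets_def)
qed

text \<open>On the event that point 1 has label 1 and point 2 has label 0, the mixed label is the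
  mixing weight and the mixed point is \<open>\<mu> * (2 *\<^sub>R M - 1)\<close>. The span
  condition gives a mask with nonzero score, and the weight condition makes both labels count at
  that mask, so either sign of the score is penalized.\<close>

lemma nondegenerate_mask:
  assumes w: "w \<noteq> 0"
  shows "\<not> (AE \<omega> in base_law. hinge (label (1, 2) \<omega>) (w \<bullet> feature 0 (1, 2) \<omega>) = 0)"
proof
  let ?D = "msupport (distr \<M> borel fst)"
  assume ae: "AE \<omega> in base_law. hinge (label (1, 2) \<omega>) (w \<bullet> feature 0 (1, 2) \<omega>) = 0"
  have "\<exists>M\<^sub>0\<in>?D. w \<bullet> (\<mu> * (2 *\<^sub>R M\<^sub>0 - 1)) \<noteq> 0"
  proof (rule ccontr)
    assume "\<not> ?thesis"
    \<comment> \<open>A vector orthogonal to a spanning set is orthogonal to itself.\<close>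
    then have "orthogonal w w"
      using \<M>(2) by (intro orthogonal_to_span[of w "(\<lambda>M\<^sub>0. \<mu> * (2 *\<^sub>R M\<^sub>0 - 1)) ` ?D"])
        (auto simp: mask_assumption_def orthogonal_def)
    with w show False by (simp add: orthogonal_self)
  qed
  then obtain M\<^sub>0 where M\<^sub>0: "M\<^sub>0 \<in> ?D" "w \<bullet> (\<mu> * (2 *\<^sub>R M\<^sub>0 - 1)) \<noteq> 0" by blast
  \<comment> \<open>Membership in \<open>?H\<close> forces \<open>M = M\<^sub>0\<close> and a weight
    other than 0 and 1. Weights lie in the unit interval almost surely, so \<open>?H\<close> is
    contained in the rectangle \<open>?E\<close> up to a null set.\<close>
  let ?H = "{(M, l). l * indicat_real {M\<^sub>0} M \<notin> {0, 1}}" and ?E = "{M\<^sub>0} \<times> {0<..<1::real}"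
  have E: "?E \<in> sets borel" by (simp add: borel_prod[symmetric])
  have "emeasure \<M> ?E \<noteq> 0"
  proof
    assume "emeasure \<M> ?E = 0"
    then have "AE p in \<M>. p \<notin> ?E" using E by (intro AE_not_in) (simp add: null_sets_def sets_\<M>)
    then have "AE p in \<M>. p \<notin> ?H"
      using mask_distribution_AE[OF \<M>(1)]
    proof eventually_elim
      case (elim p)
      then show ?case by (cases p) (auto simp: indicator_def split: if_splits)
    qed
    moreover have pos: "0 < measure \<M> ?H" using \<M>(2) M\<^sub>0(1) by (auto simp: mask_assumption_def)
    \<comment> \<open>\<open>measure\<close> is 0 on non-measurable sets, so positivity yields
      measurability.\<close>
    then have "?H \<in> sets \<M>" by (metis less_irrefl measure_notin_sets)
    ultimately have "?H \<in> null_sets \<M>" by (simp add: AE_iff_null_sets)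
    with pos show False by (simp add: measure_eq_0_null_sets)
  qed
  moreover
  \<comment> \<open>Only \<open>B 1\<close> and \<open>B 2\<close> are used: label 1 for the first
    point and label 0 for the second. By independence, these events and \<open>?E\<close> occur
    together with positive probability.\<close>
  define B :: "nat \<Rightarrow> ((real^'d) \<times> real) set" where "B i = (if i = 1 then UNIV \<times> {1} else UNIV \<times> {0})" for i
  have B: "B i \<in> sets Q" for i by (simp add: B_def sets_Q borel_prod[symmetric])
  have Bpos: "emeasure Q (B i) \<noteq> 0" for i
  proof
    assume "emeasure Q (B i) = 0"
    then have "AE p in Q. p \<notin> B i" using B by (intro AE_not_in) (simp add: null_sets_def)
    moreover have "{p \<in> space borel. p \<notin> B i} \<in> sets borel" using B[of i] unfolding sets_Q by measurable
    ultimately have "\<forall>y\<in>{0, 1}. AE g in gaussian 0 \<Sigma>. (g, y) \<notin> B i"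
      by (subst (asm) AE_noise_law_iff[OF \<Sigma>]) (auto simp: pred_def)
    then have "AE g in gaussian 0 \<Sigma>. False" by (auto simp: B_def split: if_splits)
    then show False using prob_space.AE_False[OF prob_space_gaussian_0[OF \<Sigma>]] by simp
  qed
  interpret Q: product_prob_space "\<lambda>_::nat. Q" I by (rule product_prob_spaceI) (rule prob_Q)
  interpret M: product_prob_space "\<lambda>_::nat \<times> nat. \<M>" K by (rule product_prob_spaceI) (rule prob_\<M>)
  let ?S = "{S \<in> space (\<Pi>\<^sub>M i\<in>I. Q). \<forall>i\<in>{1, 2}. S i \<in> B i}"
  let ?T = "{T \<in> space (\<Pi>\<^sub>M k\<in>K. \<M>). \<forall>k\<in>{(1, 2)}. T k \<in> ?E}"
  have sub: "{1, 2} \<subseteq> I" "{(1, 2)} \<subseteq> K" using n by auto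
  have S: "emeasure (\<Pi>\<^sub>M i\<in>I. Q) ?S = (\<Prod>i\<in>{1, 2}. emeasure Q (B i))"
    using B sub by (intro Q.emeasure_PiM_Collect) auto
  have T: "emeasure (\<Pi>\<^sub>M k\<in>K. \<M>) ?T = (\<Prod>k\<in>{(1::nat, 2::nat)}. emeasure \<M> ?E)"
    using E sub by (intro M.emeasure_PiM_Collect) (auto simp: sets_\<M>)
  have "?S \<in> sets (\<Pi>\<^sub>M i\<in>I. Q)" "?T \<in> sets (\<Pi>\<^sub>M k\<in>K. \<M>)"
    using B E sub by (auto intro!: sets.sets_Collect_finite_All simp: sets_\<M>)
  then have ST: "?S \<times> ?T \<in> sets base_law"
    and "emeasure base_law (?S \<times> ?T) = emeasure (\<Pi>\<^sub>M i\<in>I. Q) ?S * emeasure (\<Pi>\<^sub>M k\<in>K. \<M>) ?T"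
    unfolding base_law_def
    by (auto intro!: sigma_finite_measure.emeasure_pair_measure_Times prob_space_imp_sigma_finite prob_space_PiM prob_\<M>)
  ultimately have ne: "emeasure base_law (?S \<times> ?T) \<noteq> 0"
    using Bpos unfolding S T by simp
  from ae have "AE \<omega> in base_law. \<omega> \<notin> ?S \<times> ?T"
  proof eventually_elim
    case (elim \<omega>)
    show ?case
    proof
      assume \<omega>: "\<omega> \<in> ?S \<times> ?T"
      then have y: "snd (fst \<omega> 1) = 1" "snd (fst \<omega> 2) = 0"
        and m: "fst (snd \<omega> (1, 2)) = M\<^sub>0" "0 < snd (snd \<omega> (1, 2))" "snd (snd \<omega> (1, 2)) < 1"
        by (auto simp: B_def)
      have "label (1, 2) \<omega> = snd (snd \<omega> (1, 2))" "feature 0 (1, 2) \<omega> = \<mu> * (2 *\<^sub>R M\<^sub>0 - 1)"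
        by (simp_all add: label_def feature_def data_of_noise_def mask_mix_y_def y m mask_mix_x_uminus del: One_nat_def)
      \<comment> \<open>The mixed label is strictly between 0 and 1, so the hinge loss is positive
        for a score of either sign.\<close>
      then show False
        using elim m M\<^sub>0(2) hinge_pos[of "label (1, 2) \<omega>" "w \<bullet> feature 0 (1, 2) \<omega>"]
        by (cases "w \<bullet> feature 0 (1, 2) \<omega> < 0") auto
    qed
  qed
  then have "?S \<times> ?T \<in> null_sets base_law" using ST by (simp add: AE_iff_null_sets)
  with ne show False by (simp add: null_sets_def)
qed

section \<open>The family of risks indexed by the noise level\<close>

lemma soft_classifier:
  assumes s: "0 \<le> s" shows "soft_classifier base_law K (1 / (real n)\<^sup>2) label (feature s)"
proof -
  interpret prob_space base_law by (rule prob_base_law)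
  show ?thesis
  proof
    show "\<exists>k\<in>K. \<not> (AE \<omega> in base_law. hinge (label k \<omega>) (w \<bullet> feature s k \<omega>) = 0)" if "w \<noteq> 0" for w
    proof (cases "s = 0")
      case True
      then show ?thesis using nondegenerate_mask[OF that] n by (intro bexI[of _ "(1, 2)"]) auto
    next
      case False
      then show ?thesis using nondegenerate_noise[of s, OF _ that] s n by (intro bexI[of _ "(1, 1)"]) auto
    qed
  qed (use n s AE_label_bounds integrable_feature in auto)
qed

definition noisy_risk where
  "noisy_risk s = soft_classifier.risk base_law K (1 / (real n)\<^sup>2) label (feature s)"

lemma noisy_risk_eq:
  assumes "0 \<le> s"
  shows "noisy_risk s w = 1 / (real n)\<^sup>2 * (\<Sum>k\<in>K. \<integral>\<omega>. soft_loss (label k \<omega>) (w \<bullet> feature s k \<omega>) \<partial>base_law)"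
  unfolding noisy_risk_def soft_classifier.risk_def[OF soft_classifier[OF assms]] ..

text \<open>The loss is 1-Lipschitz in the score and the features move by at most \<open>s\<close>
  times the noise norms; \<open>C\<close> averages the expected norms over all index pairs.\<close>

lemma noisy_risk_lipschitz:
  obtains C where "0 \<le> C" "\<And>s w. 0 \<le> s \<Longrightarrow> \<bar>noisy_risk s w - noisy_risk 0 w\<bar> \<le> C * s * norm w"
proof
  let ?G = "\<lambda>k \<omega>. norm (fst (fst \<omega> (fst k))) + norm (fst (fst \<omega> (snd k)))"
  let ?C = "1 / (real n)\<^sup>2 * (\<Sum>k\<in>K. \<integral>\<omega>. ?G k \<omega> \<partial>base_law)"
  show "0 \<le> ?C" by (intro mult_nonneg_nonneg sum_nonneg integral_nonneg) auto
  fix s :: real and w :: "real^'d" assume s: "0 \<le> s"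
  let ?J = "\<lambda>s k. \<integral>\<omega>. soft_loss (label k \<omega>) (w \<bullet> feature s k \<omega>) \<partial>base_law"
  note int = soft_classifier.integrable_soft_loss[OF soft_classifier]
  have J: "\<bar>?J s k - ?J 0 k\<bar> \<le> s * norm w * (\<integral>\<omega>. ?G k \<omega> \<partial>base_law)" if k: "k \<in> K" for k
  proof -
    have k12: "fst k \<in> I" "snd k \<in> I" using k by auto
    have "\<bar>?J s k - ?J 0 k\<bar> = norm (\<integral>\<omega>. soft_loss (label k \<omega>) (w \<bullet> feature s k \<omega>) - soft_loss (label k \<omega>) (w \<bullet> feature 0 k \<omega>) \<partial>base_law)"
      using int[OF s k] int[OF order_refl k] by simp
    also have "\<dots> \<le> (\<integral>\<omega>. s * norm w * ?G k \<omega> \<partial>base_law)"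
    proof (rule order_trans[OF integral_norm_bound], rule integral_mono_AE)
      show "integrable base_law (\<lambda>\<omega>. s * norm w * ?G k \<omega>)"
        using k12 by (intro integrable_mult_right Bochner_Integration.integrable_add integrable_noise)
      show "AE \<omega> in base_law. norm (soft_loss (label k \<omega>) (w \<bullet> feature s k \<omega>) - soft_loss (label k \<omega>) (w \<bullet> feature 0 k \<omega>))
          \<le> s * norm w * ?G k \<omega>"
        using AE_label_bounds[OF k] AE_feature_diff_le[OF k s]
      proof eventually_elim
        case (elim \<omega>)
        have "norm (soft_loss (label k \<omega>) (w \<bullet> feature s k \<omega>) - soft_loss (label k \<omega>) (w \<bullet> feature 0 k \<omega>))
            \<le> \<bar>w \<bullet> (feature s k \<omega> - feature 0 k \<omega>)\<bar>"
          using elim(1) soft_loss_lipschitz by (simp add: inner_diff_right)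
        also have "\<dots> \<le> norm w * norm (feature s k \<omega> - feature 0 k \<omega>)" by (rule Cauchy_Schwarz_ineq2)
        also have "\<dots> \<le> norm w * (s * ?G k \<omega>)" using elim(2) by (intro mult_left_mono) auto
        finally show ?case by (simp add: mult_ac)
      qed
    qed (intro integrable_norm Bochner_Integration.integrable_diff int s order_refl k)
    finally show ?thesis by simp
  qed
  have "\<bar>noisy_risk s w - noisy_risk 0 w\<bar> = 1 / (real n)\<^sup>2 * \<bar>\<Sum>k\<in>K. ?J s k - ?J 0 k\<bar>"
    by (simp only: noisy_risk_eq[OF s] noisy_risk_eq[OF order_refl] right_diff_distrib[symmetric]
        sum_subtractf[symmetric] abs_mult) simp
  also have "\<dots> \<le> 1 / (real n)\<^sup>2 * (\<Sum>k\<in>K. s * norm w * (\<integral>\<omega>. ?G k \<omega> \<partial>base_law))"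
    by (intro mult_left_mono order_trans[OF sum_abs] sum_mono J) auto
  also have "\<dots> = ?C * s * norm w" by (simp only: sum_distrib_left[symmetric] mult_ac)
  finally show "\<bar>noisy_risk s w - noisy_risk 0 w\<bar> \<le> ?C * s * norm w" .
qed

section \<open>Identification with the expected Mixup loss\<close>

text \<open>A product of image measures is the image of the product. \<open>compose\<close>
  restricts to \<open>I\<close>, since points of a product space are functions that are
  \<open>undefined\<close> outside the index set.\<close>

lemma sample_law_eq_distr:
  assumes k: "0 < \<kappa>"
  shows "sample_law \<mu> \<Sigma> \<M> n \<kappa> = distr base_law ((\<Pi>\<^sub>M i\<in>I. borel) \<Otimes>\<^sub>M (\<Pi>\<^sub>M k\<in>K. \<M>))
    (\<lambda>(S, T). (compose I (data_of_noise \<mu> (noise_scale \<kappa>)) S, T))"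
proof -
  let ?f = "data_of_noise \<mu> (noise_scale \<kappa>)"
  let ?L = "distr Q borel ?f"
  have f: "?f \<in> Q \<rightarrow>\<^sub>M borel" by measurable
  have L: "prob_space ?L" using prob_Q f by (rule prob_space.prob_space_distr)
  have setsL: "sets (\<Pi>\<^sub>M i\<in>I. ?L) = sets (\<Pi>\<^sub>M i\<in>I. borel)" by (intro sets_PiM_cong) auto
  have comp: "compose I ?f \<in> (\<Pi>\<^sub>M i\<in>I. Q) \<rightarrow>\<^sub>M (\<Pi>\<^sub>M i\<in>I. borel)"
    unfolding compose_def by measurable
  have "distr Q ?L ?f = ?L" by (intro distr_cong) auto
  then have "(\<Pi>\<^sub>M i\<in>I. ?L) = distr (\<Pi>\<^sub>M i\<in>I. Q) (\<Pi>\<^sub>M i\<in>I. ?L) (compose I ?f)"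
    using distr_PiM_finite_prob_space'[of I "\<lambda>_. Q" "\<lambda>_. ?L" ?f] prob_Q L f by simp
  also have "\<dots> = distr (\<Pi>\<^sub>M i\<in>I. Q) (\<Pi>\<^sub>M i\<in>I. borel) (compose I ?f)"
    by (intro distr_cong setsL) auto
  finally have 1: "(\<Pi>\<^sub>M i\<in>I. ?L) = distr (\<Pi>\<^sub>M i\<in>I. Q) (\<Pi>\<^sub>M i\<in>I. borel) (compose I ?f)" .
  \<comment> \<open>The mask factor is treated as its own image under the identity, so that
    \<open>pair_measure_distr\<close> applies to both factors.\<close>
  have "sigma_finite_measure (distr (\<Pi>\<^sub>M k\<in>K. \<M>) (\<Pi>\<^sub>M k\<in>K. \<M>) (\<lambda>x. x))"
    using prob_space_PiM[of K "\<lambda>_. \<M>"] prob_\<M> by (simp add: prob_space_imp_sigma_finite)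
  from pair_measure_distr[OF comp measurable_ident_sets[OF refl] this]
  show ?thesis
    unfolding sample_law_def data_law_eq_distr[OF \<Sigma> k] 1 base_law_def by simp
qed

lemma expected_mask_loss_eq_noisy_risk:
  assumes k: "0 < \<kappa>"
  shows "expected_mask_loss \<mu> \<Sigma> \<M> n \<kappa> = noisy_risk (noise_scale \<kappa>)"
proof
  fix w
  let ?s = "noise_scale \<kappa>"
  let ?f = "data_of_noise \<mu> ?s"
  let ?N = "(\<Pi>\<^sub>M i\<in>I. borel) \<Otimes>\<^sub>M (\<Pi>\<^sub>M k\<in>K. \<M>)"
  have comp: "(\<lambda>(S, T). (compose I ?f S, T)) \<in> base_law \<rightarrow>\<^sub>M ?N"
    unfolding base_law_def compose_def by measurable
  have loss: "mask_loss n S T w = 1 / (real n)\<^sup>2 * (\<Sum>k\<in>K. soft_loss (mask_mix_y (snd (T k)) (snd (S (fst k))) (snd (S (snd k))))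
      (w \<bullet> mask_mix_x (fst (T k)) (fst (S (fst k))) (fst (S (snd k)))))" for S :: "nat \<Rightarrow> (real^'d) \<times> real" and T
    by (simp add: mask_loss_def soft_loss_def Let_def sum.cartesian_product split_beta)
  have meas: "(\<lambda>(S, T). mask_loss n S T w) \<in> borel_measurable ?N"
    unfolding loss split_beta
  proof (intro borel_measurable_times borel_measurable_const borel_measurable_sum)
    fix k assume [measurable]: "k \<in> K"
    then have [measurable]: "fst k \<in> I" "snd k \<in> I" by auto
    show "(\<lambda>p. soft_loss (mask_mix_y (snd (snd p k)) (snd (fst p (fst k))) (snd (fst p (snd k))))
      (w \<bullet> mask_mix_x (fst (snd p k)) (fst (fst p (fst k))) (fst (fst p (snd k))))) \<in> borel_measurable ?N"
      by measurable
  qed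
  have eq: "mask_loss n (compose I ?f S) T w
      = 1 / (real n)\<^sup>2 * (\<Sum>k\<in>K. soft_loss (label k (S, T)) (w \<bullet> feature ?s k (S, T)))" for S T
    unfolding loss by (intro arg_cong2[where f = "(*)"] refl sum.cong)
      (auto simp: compose_def label_def feature_def data_of_noise_def)
  have "expected_mask_loss \<mu> \<Sigma> \<M> n \<kappa> w
      = (\<integral>\<omega>. mask_loss n (compose I ?f (fst \<omega>)) (snd \<omega>) w \<partial>base_law)"
    unfolding expected_mask_loss_def sample_law_eq_distr[OF k]
    by (subst integral_distr[OF comp meas]) (simp add: split_beta)
  also have "\<dots> = noisy_risk ?s w"
    unfolding eq noisy_risk_eq[OF noise_scale_nonneg[OF k]] prod.collapse
    using soft_classifier.integrable_soft_loss[OF soft_classifier[OF noise_scale_nonneg[OF k]]]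
    by (subst integral_mult_right_zero, subst Bochner_Integration.integral_sum) auto
  finally show "expected_mask_loss \<mu> \<Sigma> \<M> n \<kappa> w = noisy_risk ?s w" .
qed

lemma ex1_minimizer: "0 \<le> s \<Longrightarrow> \<exists>!w. is_arg_min (noisy_risk s) (\<lambda>w. True) w"
  unfolding noisy_risk_def by (rule soft_classifier.ex1_risk_minimizer[OF soft_classifier])

lemma minimizer_tendsto_0:
  "((\<lambda>s. arg_min (noisy_risk s) (\<lambda>w. True)) \<longlongrightarrow> arg_min (noisy_risk 0) (\<lambda>w. True)) (at_right 0)"
proof -
  interpret soft_classifier base_law K "1 / (real n)\<^sup>2" label "feature 0" by (rule soft_classifier) simp
  obtain b where b: "0 < b" "\<And>w. b * norm w \<le> noisy_risk 0 w"
    using risk_coercive unfolding noisy_risk_def by blast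
  obtain C where C: "0 \<le> C" "\<And>s w. 0 \<le> s \<Longrightarrow> \<bar>noisy_risk s w - noisy_risk 0 w\<bar> \<le> C * s * norm w"
    using noisy_risk_lipschitz by blast
  \<comment> \<open>\<open>arg_min\<close> is a choice; existence of a minimizer makes the chosen
    point one.\<close>
  have min: "is_arg_min (noisy_risk s) (\<lambda>w. True) (arg_min (noisy_risk s) (\<lambda>w. True))" if "0 \<le> s" for s
    using ex1_minimizer[OF that] unfolding arg_min_def by (metis someI_ex)
  show ?thesis
  proof (rule minimizer_tendsto[OF _ b C min])
    show "continuous_on UNIV (noisy_risk 0)" unfolding noisy_risk_def by (rule continuous_on_risk)
    show "v = arg_min (noisy_risk 0) (\<lambda>w. True)" if "is_arg_min (noisy_risk 0) (\<lambda>w. True) v" for v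
      using that min[of 0] ex1_minimizer[of 0] by blast
  qed
qed

end

theorem theorem5p3:
  fixes \<mu> :: "real^'d" and \<Sigma> :: "real^'d^'d"
    and \<M> :: "((real^'d) \<times> real) measure" and n :: nat
  assumes "\<mu> \<noteq> 0"
    and "pos_def_matrix \<Sigma>"
    and "(norm \<mu>)\<^sup>2 = spectral_norm \<Sigma>"
    and "mask_distribution \<M>"
    and "mask_assumption \<mu> \<M>"
    and "n \<ge> 2"
  shows "(\<forall>\<kappa>::ereal. 0 < \<kappa> \<longrightarrow>
            (\<exists>!w. is_arg_min (expected_mask_loss \<mu> \<Sigma> \<M> n \<kappa>) (\<lambda>w. True) w)) \<and>
         ((\<lambda>\<kappa>::real. w_mask \<mu> \<Sigma> \<M> n (ereal \<kappa>)) \<longlongrightarrow> w_mask \<mu> \<Sigma> \<M> n \<infinity>) at_top"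
proof -
  interpret mask_model \<mu> \<Sigma> \<M> n by unfold_locales fact+
  let ?m = "\<lambda>s. arg_min (noisy_risk s) (\<lambda>w. True)"
  have m: "w_mask \<mu> \<Sigma> \<M> n \<kappa> = ?m (noise_scale \<kappa>)" if "0 < \<kappa>" for \<kappa>
    by (simp add: w_mask_def expected_mask_loss_eq_noisy_risk[OF that])
  \<comment> \<open>The noise level tends to 0 through positive values, so the limit in
    \<open>s\<close> from the right becomes the limit in \<kappa>.\<close>
  have "filterlim (\<lambda>\<kappa>. 1 / sqrt \<kappa>) (at_right 0) at_top"
    unfolding filterlim_at
    by (auto intro!: tendsto_divide_0[OF tendsto_const] filterlim_at_top_imp_at_infinity sqrt_at_top
        eventually_mono[OF eventually_gt_at_top[of 0]])
  from filterlim_compose[OF minimizer_tendsto_0 this]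
  have "((\<lambda>\<kappa>. w_mask \<mu> \<Sigma> \<M> n (ereal \<kappa>)) \<longlongrightarrow> ?m 0) at_top"
    \<comment> \<open>\<open>w_mask\<close> is identified with the coupled minimizer for positive
      \<kappa> only, which holds eventually.\<close>
    by (rule Lim_transform_eventually)
      (auto simp: m noise_scale_def intro: eventually_mono[OF eventually_gt_at_top[of 0]])
  then show ?thesis
    using ex1_minimizer noise_scale_nonneg m[of "\<infinity>"]
    by (auto simp: expected_mask_loss_eq_noisy_risk noise_scale_def)
qed

end
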